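(* The sequences $(W\!gp_k)_{k\ge1}$ and $(W\!gc_k)_{k\ge2}$ satisfy $$\lim_{k\to\infty}\frac{\mathcal{E}(W\!gp_k)}{\mu(W\!gp_k)}=\lim_{k\to\infty}\frac{\mathcal{E}(W\!gc_k)}{\mu(W\!gc_k)}=L,$$ where $$L=1-\alpha(-2)+\frac{1}{\pi}\int_{\alpha(2)}^{\alpha(-2)}\arccos\!\left(\frac{\mathcal{F}(x)}{2}\right)dx+\frac{1}{\pi}\int_{\beta(2)}^{0}\arccos\!\left(\frac{\mathcal{F}(x)}{2}\right)dx.$$
   Context: The energy $\mathcal{E}(G)$ of a graph $G$ is the sum of the absolute values of the eigenvalues of its adjacency matrix; $\mu(G)$ is the matching number (number of edges in a maximum matching) of $G$. For $k\ge1$, the wine glass path $W\!gp_k$ has vertices $p_0,\dots,p_k$ and $q_j,r_j,s_j,t_j$ ($0\le j\le k-1$) and edges $p_jq_j$, $q_jp_{j+1}$, $q_jr_j$, $r_js_j$, $r_jt_j$, $s_jt_j$ ($0\le j\le k-1$). For $k\ge2$, the wine glass cycle $W\!gc_k$ has vertices $p_j,q_j,r_j,s_j,t_j$ ($0\le j\le k-1$) and the same edges with indices modulo $k$ (so $q_{k-1}$ is adjacent to $p_0$). Both have matching number $2k$. Let $\mathcal{F}(x)=x^2-3-\frac{2}{(x+1)(x-2)}$ for $x\in\mathbb{R}\setminus\{-1,2\}$. For each $y\in[-2,2]$ the equation $\mathcal{F}(x)=y$ has exactly four distinct real solutions, one in each of $(-\infty,-1)$, $(-1,0]$, $(0,2)$,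 $(2,+\infty)$; the ones in $(-\infty,-1)$ and $(-1,0]$ are denoted $\alpha(y)$ and $\beta(y)$ respectively. *)

theory Defs
  imports "HOL-Analysis.Analysis" "Jordan_Normal_Form.Char_Poly"
begin

text \<open>A finite simple graph \<open>(n, E)\<close> has vertex set \<open>{0..<n}\<close> and edge set \<open>E\<close>, a set of
  two-element subsets of \<open>{0..<n}\<close>.\<close>

type_synonym graph = "nat \<times> nat set set"

definition adjacency_matrix :: "graph \<Rightarrow> real Matrix.mat" where
  "adjacency_matrix G =
     Matrix.mat (fst G) (fst G) (\<lambda>(i, j). if {i, j} \<in> snd G then 1 else 0)"

text \<open>Eigenvalues are counted with (algebraic) multiplicity. The adjacency matrix is real
  symmetric, so its real eigenvalues are all of its eigenvalues.\<close>

definition graph_energy :: "graph \<Rightarrow> real" where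
  "graph_energy G =
     (\<Sum>x | eigenvalue (adjacency_matrix G) x.
        real (Polynomial.order x (char_poly (adjacency_matrix G))) * \<bar>x\<bar>)"

definition matching :: "graph \<Rightarrow> nat set set \<Rightarrow> bool" where
  "matching G M \<longleftrightarrow> M \<subseteq> snd G \<and> (\<forall>e\<in>M. \<forall>f\<in>M. e \<noteq> f \<longrightarrow> e \<inter> f = {})"

definition matching_number :: "graph \<Rightarrow> nat" where
  "matching_number G = Max (card ` {M. matching G M})"

text \<open>Numbering of the named vertices: \<open>p\<^sub>j, q\<^sub>j, r\<^sub>j, s\<^sub>j, t\<^sub>j\<close> with \<open>0 \<le> j < k\<close> exhaust
  \<open>{0..<5 * k}\<close>, and \<open>p\<^sub>k\<close> is the number \<open>5 * k\<close>.\<close>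

definition vp :: "nat \<Rightarrow> nat" where "vp j = 5 * j"
definition vq :: "nat \<Rightarrow> nat" where "vq j = 5 * j + 1"
definition vr :: "nat \<Rightarrow> nat" where "vr j = 5 * j + 2"
definition vs :: "nat \<Rightarrow> nat" where "vs j = 5 * j + 3"
definition vt :: "nat \<Rightarrow> nat" where "vt j = 5 * j + 4"

definition wine_glass_path :: "nat \<Rightarrow> graph" where
  "wine_glass_path k =
     (5 * k + 1,
      (\<Union>j<k. {{vp j, vq j}, {vq j, vp (j + 1)}, {vq j, vr j},
              {vr j, vs j}, {vr j, vt j}, {vs j, vt j}}))"

definition wine_glass_cycle :: "nat \<Rightarrow> graph" where
  "wine_glass_cycle k =
     (5 * k,
      (\<Union>j<k. {{vp j, vq j}, {vq j, vp ((j + 1) mod k)}, {vq j, vr j},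
              {vr j, vs j}, {vr j, vt j}, {vs j, vt j}}))"

definition wg_F :: "real \<Rightarrow> real" where
  "wg_F x = x\<^sup>2 - 3 - 2 / ((x + 1) * (x - 2))"

text \<open>For \<open>y \<in> [-2, 2]\<close> the equation \<open>wg_F x = y\<close> has exactly one solution in each of the
  intervals \<open>(-\<infinity>, -1)\<close> and \<open>(-1, 0]\<close>.\<close>

definition wg_alpha :: "real \<Rightarrow> real" where
  "wg_alpha y = (THE x. x \<in> {..< -1} \<and> wg_F x = y)"

definition wg_beta :: "real \<Rightarrow> real" where
  "wg_beta y = (THE x. x \<in> {-1<..0} \<and> wg_F x = y)"

definition wg_L :: real where
  "wg_L = 1 - wg_alpha (-2)
     + 1 / pi * integral {wg_alpha 2..wg_alpha (-2)} (\<lambda>x. arccos (wg_F x / 2))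
     + 1 / pi * integral {wg_beta 2..0} (\<lambda>x. arccos (wg_F x / 2))"

end

theory Submission
  imports Defs
begin

text \<open>
  An eigenvector for an eigenvalue \<open>x \<noteq> -1\<close> is symmetric in \<open>s\<^sub>j\<close> and \<open>t\<^sub>j\<close>; eliminating
  \<open>p, r, s, t\<close> leaves the wave equation \<open>q\<^bsub>j-1\<^esub> + q\<^bsub>j+1\<^esub> = F(x) q\<^sub>j\<close>. Hence, apart from \<open>-1\<close> with
  multiplicity \<open>k\<close> (and a simple \<open>0\<close> for the path), the spectrum consists of the four roots of
  \<open>F(x) = 2 cos \<theta>\<close>, where \<open>\<theta>\<close> runs through \<open>m \<pi> / (k + 1)\<close> for the path and \<open>2 m \<pi> / k\<close> for the
  cycle. The roots of one such quartic sum to 1, so their absolute values sum to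
  \<open>1 - 2 (\<alpha> + \<beta>)\<close>, and the energy becomes a Riemann sum of \<open>(\<alpha> + \<beta>)(2 cos \<theta>)\<close>, whose integral
  is converted into the integral of the inverse function \<open>arccos (F(x) / 2)\<close>.

  Multiplicities are obtained by counting distinct eigenvalues. For the cycle, where the
  values \<open>2 cos \<theta>\<close> come in pairs, the edges \<open>q\<^sub>j p\<^bsub>j+1\<^esub>\<close> first get complex phases
  that separate them.
\<close>

subsection \<open>The quartic with roots \<open>F(x) = y\<close>\<close>

text \<open>This is the equation \<open>wg_F x = y\<close> after clearing the denominator,
  \<open>(x + 1) * (x - 2) * (x^2 - 3 - y) - 2\<close>. The coefficient ring is general because the
  quartic is needed over the reals and, for matrices with phases, over the complex numbers.\<close>

definition wg_Q :: "'a::comm_ring_1 \<Rightarrow> 'a poly" where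
  "wg_Q y = [:4 + 2 * y, 3 + y, - (5 + y), -1, 1:]"

lemma poly_wg_Q: "poly (wg_Q y) x = (x + 1) * (x - 2) * (x\<^sup>2 - 3 - y) - 2"
  by (simp add: wg_Q_def algebra_simps power2_eq_square)

lemma degree_wg_Q [simp]: "degree (wg_Q y) = 4"
  by (simp add: wg_Q_def)

lemma coeff_wg_Q_4 [simp]: "coeff (wg_Q y) 4 = 1"
  by (simp add: wg_Q_def numeral_eq_Suc)

lemma wg_F_eq_iff:
  assumes "x \<noteq> -1" "x \<noteq> 2"
  shows "wg_F x = y \<longleftrightarrow> poly (wg_Q y) x = 0"
proof -
  have "(x + 1) * (x - 2) \<noteq> 0" using assms by auto
  then have "x\<^sup>2 - 3 - y = 2 / ((x + 1) * (x - 2)) \<longleftrightarrow> (x\<^sup>2 - 3 - y) * ((x + 1) * (x - 2)) = 2"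
    by (rule nonzero_eq_divide_eq)
  moreover have "wg_F x = y \<longleftrightarrow> x\<^sup>2 - 3 - y = 2 / ((x + 1) * (x - 2))"
    unfolding wg_F_def by auto
  ultimately show ?thesis by (simp add: poly_wg_Q mult.commute)
qed

lemma poly_wg_Q_nonzero: "poly (wg_Q y) (-1::real) \<noteq> 0" "poly (wg_Q y) (2::real) \<noteq> 0"
  by (auto simp: poly_wg_Q)

lemma poly_four_linear_factors:
  fixes a b c d x :: "'a::comm_ring_1"
  shows "poly ([:-a, 1:] * [:-b, 1:] * [:-c, 1:] * [:-d, 1:]) x = (x - a) * (x - b) * (x - c) * (x - d)"
  by (simp only: poly_mult) simp

text \<open>Sign changes locate four distinct roots by the intermediate value theorem, and the cubic
  coefficient gives their sum.\<close>

lemma wg_Q_factorization: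
  fixes y :: real
  assumes y: "y \<in> {-2..2}"
  obtains a b c d where "-3 < a" "a < -1" "-1 < b" "b \<le> 0" "0 < c" "c < 2" "2 < d"
    "wg_Q y = [:-a, 1:] * [:-b, 1:] * [:-c, 1:] * [:-d, 1:]" "a + b + c + d = 1"
proof -
  have cont: "continuous_on S (poly (wg_Q y))" for S by (intro continuous_intros)
  \<comment> \<open>For \<open>y = -2\<close> the value at 0 vanishes, so 0 cannot separate
    \<open>b\<close> from a positive \<open>c\<close>. At 1/4 the value is least for
    \<open>y = -2\<close>, where it is still 13/256.\<close>
  have v: "poly (wg_Q y) (-3) > 0" "poly (wg_Q y) (-1) < 0" "poly (wg_Q y) 0 \<ge> 0"
    "poly (wg_Q y) (1/4) > 0" "poly (wg_Q y) 2 < 0" "poly (wg_Q y) 3 > 0"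
    using y by (auto simp: poly_wg_Q power2_eq_square algebra_simps)
  obtain a where a: "-3 \<le> a" "a \<le> -1" "poly (wg_Q y) a = 0"
    using IVT2'[of "poly (wg_Q y)" "-1" 0 "-3"] v cont by force
  obtain b where b: "-1 \<le> b" "b \<le> 0" "poly (wg_Q y) b = 0"
    using IVT'[of "poly (wg_Q y)" "-1" 0 0] v cont by force
  obtain c where c: "1/4 \<le> c" "c \<le> 2" "poly (wg_Q y) c = 0"
    using IVT2'[of "poly (wg_Q y)" 2 0 "1/4"] v cont by force
  obtain d where d: "2 \<le> d" "d \<le> 3" "poly (wg_Q y) d = 0"
    using IVT'[of "poly (wg_Q y)" 2 0 3] v cont by force
  have "a \<noteq> -3" "a \<noteq> -1" "b \<noteq> -1" "c \<noteq> 2" "d \<noteq> 2" using a b c d v by auto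
  then have s: "-3 < a" "a < -1" "-1 < b" "c < 2" "2 < d" using a b c d by auto
  \<comment> \<open>Two monic quartics that agree at four distinct points are equal.\<close>
  have fact: "wg_Q y = [:-a, 1:] * [:-b, 1:] * [:-c, 1:] * [:-d, 1:]"
  proof (rule poly_eqI_degree_lead_coeff[where n = 4 and A = "{a, b, c, d}"])
    show "card {a, b, c, d} \<ge> 4" using s a b c d by (auto simp: card_insert_if)
    show "poly (wg_Q y) z = poly ([:-a, 1:] * [:-b, 1:] * [:-c, 1:] * [:-d, 1:]) z"
      if "z \<in> {a, b, c, d}" for z
      unfolding poly_four_linear_factors using that a b c d by auto
    show "coeff (wg_Q y) 4 = coeff ([:-a, 1:] * [:-b, 1:] * [:-c, 1:] * [:-d, 1:]) 4"
      unfolding coeff_wg_Q_4 by (simp add: numeral_eq_Suc)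
  qed simp_all
  have "coeff (wg_Q y) 3 = coeff ([:-a, 1:] * [:-b, 1:] * [:-c, 1:] * [:-d, 1:]) 3"
    using fact by simp
  then have "a + b + c + d = 1"
    by (simp add: wg_Q_def numeral_eq_Suc)
  with c(1) show thesis by (intro that[OF s(1-3) b(2) _ s(4,5) fact]) auto
qed

text \<open>Away from -1 and 2 the solutions of \<open>wg_F x = y\<close> are the roots of the
  quartic, and each of the two intervals contains exactly one of them. This resolves both definite
  descriptions.\<close>

lemma wg_alpha_wg_beta_factorization:
  fixes y :: real
  assumes y: "y \<in> {-2..2}"
  obtains c d where "wg_alpha y < -1" "-1 < wg_beta y" "wg_beta y \<le> 0" "0 < c" "2 < d"
    "wg_Q y = [:-wg_alpha y, 1:] * [:-wg_beta y, 1:] * [:-c, 1:] * [:-d, 1:]"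
    "wg_alpha y + wg_beta y + c + d = 1" "c \<noteq> d"
proof -
  from wg_Q_factorization[OF y] obtain a b c d where
    s: "-3 < a" "a < -1" "-1 < b" "b \<le> 0" "0 < c" "c < 2" "2 < d"
    and Q: "wg_Q y = [:-a, 1:] * [:-b, 1:] * [:-c, 1:] * [:-d, 1:]" "a + b + c + d = 1" .
  have root: "poly (wg_Q y) x = 0 \<longleftrightarrow> x = a \<or> x = b \<or> x = c \<or> x = d" for x
    unfolding Q poly_four_linear_factors by auto
  have F: "wg_F x = y \<longleftrightarrow> x = a \<or> x = b \<or> x = c \<or> x = d" if "x \<noteq> -1" "x \<noteq> 2" for x
    using wg_F_eq_iff[OF that] root by simp
  have "wg_alpha y = a"
    unfolding wg_alpha_def
  proof (rule the_equality)
    show "a \<in> {..<-1} \<and> wg_F a = y" using s F[of a] by auto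
    show "x = a" if "x \<in> {..<-1} \<and> wg_F x = y" for x using s F[of x] that by auto
  qed
  moreover have "wg_beta y = b"
    unfolding wg_beta_def
  proof (rule the_equality)
    show "b \<in> {-1<..0} \<and> wg_F b = y" using s F[of b] by auto
    show "x = b" if "x \<in> {-1<..0} \<and> wg_F x = y" for x using s F[of x] that by auto
  qed
  ultimately show thesis using that[of c d] s Q by auto
qed

lemma wg_alpha_props:
  assumes "y \<in> {-2..2}"
  shows "wg_alpha y < -1" "wg_F (wg_alpha y) = y"
    "\<And>x. x < -1 \<Longrightarrow> wg_F x = y \<Longrightarrow> wg_alpha y = x"
proof -
  obtain c d where "wg_alpha y < -1" "-1 < wg_beta y" "wg_beta y \<le> 0" "0 < c" "2 < d"
    "wg_Q y = [:-wg_alpha y, 1:] * [:-wg_beta y, 1:] * [:-c, 1:] * [:-d, 1:]"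
    using wg_alpha_wg_beta_factorization[OF assms] by metis
  note * = this
  then show "wg_alpha y < -1" by auto
  show "wg_F (wg_alpha y) = y"
    using * by (subst wg_F_eq_iff) (unfold *(6) poly_four_linear_factors, auto)
  show "wg_alpha y = x" if "x < -1" "wg_F x = y" for x
  proof -
    have "poly (wg_Q y) x = 0" using that by (subst (asm) wg_F_eq_iff) auto
    then show ?thesis using * that unfolding *(6) poly_four_linear_factors by auto
  qed
qed

lemma wg_beta_props:
  assumes "y \<in> {-2..2}"
  shows "-1 < wg_beta y" "wg_beta y \<le> 0" "wg_F (wg_beta y) = y"
    "\<And>x. -1 < x \<Longrightarrow> x \<le> 0 \<Longrightarrow> wg_F x = y \<Longrightarrow> wg_beta y = x"
proof -
  obtain c d where "wg_alpha y < -1" "-1 < wg_beta y" "wg_beta y \<le> 0" "0 < c" "2 < d"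
    "wg_Q y = [:-wg_alpha y, 1:] * [:-wg_beta y, 1:] * [:-c, 1:] * [:-d, 1:]"
    using wg_alpha_wg_beta_factorization[OF assms] by metis
  note * = this
  then show "-1 < wg_beta y" "wg_beta y \<le> 0" by auto
  show "wg_F (wg_beta y) = y" 
    using * by (subst wg_F_eq_iff) (unfold *(6) poly_four_linear_factors, auto)
  show "wg_beta y = x" if "-1 < x" "x \<le> 0" "wg_F x = y" for x
  proof -
    have "poly (wg_Q y) x = 0" using that by (subst (asm) wg_F_eq_iff) auto
    then show ?thesis using * that unfolding *(6) poly_four_linear_factors by auto
  qed
qed

section \<open>Monotonicity of F on the two branches left of 0\<close>

lemma wg_F_has_derivative:
  assumes "x \<noteq> -1" "x \<noteq> 2"
  shows "(wg_F has_real_derivative 2 * x + 2 * (2 * x - 1) / ((x + 1) * (x - 2))\<^sup>2) (at x)"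
proof -
  have nz: "(x + 1) * (x - 2) \<noteq> 0" using assms by auto
  have "((\<lambda>x. x\<^sup>2 - 3 - 2 / ((x + 1) * (x - 2))) has_real_derivative
     2 * x + 2 * (2 * x - 1) / ((x + 1) * (x - 2))\<^sup>2) (at x)"
    by (rule derivative_eq_intros refl nz | simp)+ (simp add: power2_eq_square diff_divide_distrib)
  then show ?thesis unfolding wg_F_def[abs_def] .
qed

lemma wg_F_deriv_neg:
  fixes x :: real
  assumes "x \<noteq> -1" "x \<le> 0"
  shows "2 * x + 2 * (2 * x - 1) / ((x + 1) * (x - 2))\<^sup>2 < 0"
proof -
  have "2 * (2 * x - 1) / ((x + 1) * (x - 2))\<^sup>2 < 0"
    using assms by (intro divide_neg_pos) auto
  then show ?thesis using assms by linarith
qed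

text \<open>For \<open>x \<le> 0\<close>, away from -1, the first term of the derivative is at most
  0 and the second is negative. The disjunction keeps the interval on one side of the pole at
  -1.\<close>

lemma wg_F_strict_decreasing:
  assumes "x < y" "y < -1 \<or> -1 < x \<and> y \<le> 0"
  shows "wg_F y < wg_F x"
proof (rule DERIV_neg_imp_decreasing[OF assms(1)])
  fix z assume "x \<le> z" "z \<le> y"
  then have "z \<noteq> -1" "z \<noteq> 2" "z \<le> 0" using assms by auto
  then show "\<exists>y. (wg_F has_real_derivative y) (at z) \<and> y < 0"
    using wg_F_has_derivative wg_F_deriv_neg by blast
qed

subsection \<open>The limit as an integral\<close>

text \<open>The function \<open>G = arccos (f / 2)\<close> is inverse to \<open>\<theta> \<mapsto> g (2 * cos \<theta>)\<close>; if \<open>H\<close> is a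
  primitive of the latter, then \<open>x * G x - H (G x)\<close> is a primitive of \<open>G\<close>.\<close>

lemma integral_arccos_inverse:
  fixes f g f' :: "real \<Rightarrow> real"
  assumes ab: "a \<le> b" and fa: "f a = 2" and fb: "f b = -2"
    and decr: "\<And>x y. a \<le> x \<Longrightarrow> x < y \<Longrightarrow> y \<le> b \<Longrightarrow> f y < f x"
    and deriv: "\<And>x. x \<in> {a..b} \<Longrightarrow> (f has_real_derivative f' x) (at x)"
    and inv: "\<And>x. x \<in> {a..b} \<Longrightarrow> g (f x) = x"
  shows "continuous_on {-2..2} g"
    and "integral {a..b} (\<lambda>x. arccos (f x / 2)) = pi * b - integral {0..pi} (\<lambda>t. g (2 * cos t))"
proof -
  have contf: "continuous_on {a..b} f"
    using deriv by (meson DERIV_continuous_on has_field_derivative_at_within)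
  have range: "f x \<in> {-2..2}" if "x \<in> {a..b}" for x
    using decr[of a x] decr[of x b] that fa fb by (cases "x = a"; cases "x = b") auto
  \<comment> \<open>With the image known to be all of \<open>{-2..2}\<close>, \<open>g\<close> is
    the inverse of a continuous map on a compact interval and hence continuous.\<close>
  have img: "f ` {a..b} = {-2..2}"
  proof
    show "f ` {a..b} \<subseteq> {-2..2}" using range by auto
    show "{-2..2} \<subseteq> f ` {a..b}"
    proof
      fix y :: real assume "y \<in> {-2..2}"
      then show "y \<in> f ` {a..b}"
        using IVT2'[of f b y a] fa fb ab contf by force
    qed
  qed
  show contg: "continuous_on {-2..2} g"
    unfolding img[symmetric] by (rule continuous_on_inv[OF contf]) (use inv in auto)
  define h where "h t = g (2 * cos t)" for t
  have conth: "continuous_on S h" for S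
    unfolding h_def
    by (rule continuous_on_compose2[OF contg]) (auto intro!: continuous_intros)
  define H where "H t = integral {0..t} h" for t
  have H': "(H has_real_derivative h t) (at t)" if "0 < t" "t < pi" for t
  proof -
    have "(H has_vector_derivative h t) (at t within {0..pi})"
      unfolding H_def using that by (intro integral_has_vector_derivative conth) auto
    then show ?thesis
      using that by (simp add: has_real_derivative_iff_has_vector_derivative at_within_Icc_at)
  qed
  have contH: "continuous_on {0..pi} H"
    unfolding H_def by (intro indefinite_integral_continuous_1 integrable_continuous_interval conth)
  define G where "G x = arccos (f x / 2)" for x
  have contG: "continuous_on {a..b} G"
    unfolding G_def using range by (intro continuous_intros contf) fastforce+
  have Gr: "G x \<in> {0..pi}" if "x \<in> {a..b}" for x
    using range[OF that] unfolding G_def by (auto intro!: arccos_lbound arccos_ubound)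
  have hG: "h (G x) = x" if "x \<in> {a..b}" for x
    using range[OF that] inv[OF that] unfolding h_def G_def by simp
  have "((\<lambda>x. G x) has_integral (b * G b - H (G b)) - (a * G a - H (G a))) {a..b}"
  \<comment> \<open>Only the interior is differentiated: at the endpoints \<open>f x / 2\<close> is
    1 or -1, where arccos has no derivative.\<close>
  proof (rule fundamental_theorem_of_calculus_interior[OF ab])
    have "continuous_on {a..b} (\<lambda>x. H (G x))"
      by (rule continuous_on_compose2[OF contH contG]) (use Gr in auto)
    then show "continuous_on {a..b} (\<lambda>x. x * G x - H (G x))"
      by (intro continuous_intros contG)
    fix x assume x: "x \<in> {a<..<b}"
    then have fx: "-2 < f x" "f x < 2" using decr[of a x] decr[of x b] fa fb by auto
    have G': "(G has_real_derivative inverse (- sqrt (1 - (f x / 2)\<^sup>2)) * (f' x / 2)) (at x)"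
      (is "(_ has_real_derivative ?G') _")
      unfolding G_def
      by (rule DERIV_chain2[OF DERIV_arccos DERIV_cdivide]) (use fx x deriv in auto)
    have "0 < G x" "G x < pi"
      unfolding G_def using fx arccos_lt_bounded[of "f x / 2"] by auto
    then have "((\<lambda>x. H (G x)) has_real_derivative h (G x) * ?G') (at x)"
      using DERIV_chain2[OF H' G'] by auto
    \<comment> \<open>Since \<open>h (G x) = x\<close>, the term \<open>x * G'\<close> of the
      product rule cancels against the derivative of \<open>H (G x)\<close>.\<close>
    then have "((\<lambda>x. x * G x - H (G x)) has_real_derivative G x) (at x)"
      using hG[of x] x by (auto intro!: derivative_eq_intros G')
    then show "((\<lambda>x. x * G x - H (G x)) has_vector_derivative G x) (at x)"
      by (simp add: has_real_derivative_iff_has_vector_derivative)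
  qed
  moreover have "G a = 0" "G b = pi" unfolding G_def using fa fb by auto
  moreover have "H 0 = 0" unfolding H_def by simp
  ultimately have "integral {a..b} G = pi * b - H pi"
    by (simp add: integral_unique)
  then show "integral {a..b} (\<lambda>x. arccos (f x / 2)) = pi * b - integral {0..pi} (\<lambda>t. g (2 * cos t))"
    unfolding G_def H_def h_def .
qed

lemma wg_F_less_imp_greater:
  assumes "x < -1 \<and> y < -1 \<or> -1 < x \<and> x \<le> 0 \<and> -1 < y \<and> y \<le> 0" "wg_F y < wg_F x"
  shows "x < y"
  using wg_F_strict_decreasing[of y x] assms by (cases x y rule: linorder_cases) auto

lemma wg_alpha_integral:
  "continuous_on {-2..2} wg_alpha"
  "integral {wg_alpha 2..wg_alpha (-2)} (\<lambda>x. arccos (wg_F x / 2))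
     = pi * wg_alpha (-2) - integral {0..pi} (\<lambda>t. wg_alpha (2 * cos t))"
proof -
  note al = wg_alpha_props(1,2)[of 2] wg_alpha_props(1,2)[of "-2"]
  have le: "wg_alpha 2 < wg_alpha (-2)"
    by (rule wg_F_less_imp_greater) (use al in auto)
  have rng: "wg_F x \<in> {-2..2}" if "x \<in> {wg_alpha 2..wg_alpha (-2)}" for x
    using al that wg_F_strict_decreasing[of "wg_alpha 2" x] wg_F_strict_decreasing[of x "wg_alpha (-2)"]
    by (cases "x = wg_alpha 2"; cases "x = wg_alpha (-2)") auto
  have inv: "wg_alpha (wg_F x) = x" if "x \<in> {wg_alpha 2..wg_alpha (-2)}" for x
    using wg_alpha_props(3)[OF rng[OF that], of x] that al by auto
  note I = integral_arccos_inverse[where f = wg_F and g = wg_alpha and a = "wg_alpha 2"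
      and b = "wg_alpha (-2)", OF _ _ _ _ wg_F_has_derivative inv]
  show "continuous_on {-2..2} wg_alpha"
    by (rule I(1)) (use al le in \<open>auto intro!: wg_F_strict_decreasing\<close>)
  show "integral {wg_alpha 2..wg_alpha (-2)} (\<lambda>x. arccos (wg_F x / 2))
     = pi * wg_alpha (-2) - integral {0..pi} (\<lambda>t. wg_alpha (2 * cos t))"
    by (rule I(2)) (use al le in \<open>auto intro!: wg_F_strict_decreasing\<close>)
qed

text \<open>Since \<open>wg_F 0 = -2\<close>, the upper limit 0 is the value of
  \<open>wg_beta\<close> at -2, and the boundary term \<open>pi * b\<close> of
  \<open>integral_arccos_inverse\<close> vanishes.\<close>

lemma wg_beta_integral:
  "continuous_on {-2..2} wg_beta"
  "integral {wg_beta 2..0} (\<lambda>x. arccos (wg_F x / 2)) = - integral {0..pi} (\<lambda>t. wg_beta (2 * cos t))"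
proof -
  note be = wg_beta_props(1-3)[of 2]
  have F0: "wg_F 0 = -2" by (simp add: wg_F_def)
  have le: "wg_beta 2 < 0"
    by (rule wg_F_less_imp_greater) (use be F0 in auto)
  have rng: "wg_F x \<in> {-2..2}" if "x \<in> {wg_beta 2..0}" for x
    using be that F0 wg_F_strict_decreasing[of "wg_beta 2" x] wg_F_strict_decreasing[of x 0]
    by (cases "x = wg_beta 2"; cases "x = 0") auto
  have inv: "wg_beta (wg_F x) = x" if "x \<in> {wg_beta 2..0}" for x
    using wg_beta_props(4)[OF rng[OF that], of x] that be by auto
  note I = integral_arccos_inverse[where f = wg_F and g = wg_beta and a = "wg_beta 2"
      and b = 0, OF _ _ _ _ wg_F_has_derivative inv]
  show "continuous_on {-2..2} wg_beta"
    by (rule I(1)) (use be le F0 in \<open>auto intro!: wg_F_strict_decreasing\<close>)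
  have "integral {wg_beta 2..0} (\<lambda>x. arccos (wg_F x / 2))
     = pi * 0 - integral {0..pi} (\<lambda>t. wg_beta (2 * cos t))"
    by (rule I(2)) (use be le F0 in \<open>auto intro!: wg_F_strict_decreasing\<close>)
  then show "integral {wg_beta 2..0} (\<lambda>x. arccos (wg_F x / 2))
    = - integral {0..pi} (\<lambda>t. wg_beta (2 * cos t))" by simp
qed

section \<open>Riemann sums and the integral form of L\<close>

text \<open>By uniform continuity, on a fine grid \<open>f\<close> differs from its value at the
  left end of each piece by less than \<open>e / (2 * T)\<close>. Summed over pieces of total length
  \<open>T\<close> the error is at most \<open>e / 2\<close>.\<close>

lemma riemann_sum_tendsto_integral:
  fixes f :: "real \<Rightarrow> real"
  assumes T: "0 \<le> T" and cont: "continuous_on {0..T} f"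
  shows "(\<lambda>n. T / real n * (\<Sum>j<n. f (T * real j / real n))) \<longlonglongrightarrow> integral {0..T} f"
\<comment> \<open>The bound \<open>e'\<close> divides by \<open>T\<close>; for \<open>T = 0\<close>
  both sides are 0.\<close>
proof (cases "T = 0")
  case False
  with T have T: "T > 0" by simp
  have int: "f integrable_on {a..b}" if "0 \<le> a" "b \<le> T" for a b
    using that by (intro integrable_continuous_interval continuous_on_subset[OF cont]) auto
  show ?thesis
  proof (rule metric_LIMSEQ_I)
    fix e :: real assume e: "e > 0"
    define e' where "e' = e / (2 * T)"
    have e': "e' > 0" using e T by (simp add: e'_def)
    from compact_uniformly_continuous[OF cont] obtain d where d: "d > 0"
      "\<And>x x'. x \<in> {0..T} \<Longrightarrow> x' \<in> {0..T} \<Longrightarrow> dist x' x < d \<Longrightarrow> dist (f x') (f x) < e'"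
      using e' unfolding uniformly_continuous_on_def by (metis compact_Icc)
    obtain N where N: "T / d < real N" using reals_Archimedean2 by blast
    show "\<exists>no. \<forall>n\<ge>no. dist (T / real n * (\<Sum>j<n. f (T * real j / real n))) (integral {0..T} f) < e"
    proof (intro exI allI impI)
      fix n assume n: "Suc N \<le> n"
      have Nn: "T / d < real n" using N n by linarith
      have n0: "real n > 0" using n by simp
      define x where "x j = T * real j / real n" for j
      have xs: "x (Suc j) - x j = T / real n" for j
        by (simp add: x_def algebra_simps add_divide_distrib)
      have Tn: "T / real n < d" "0 < T / real n" using Nn d(1) n0 T by (auto simp: field_simps)
      have xr: "x j \<le> T" if "j \<le> n" for j
        using that T n0 by (simp add: x_def divide_le_eq)
      have x0: "0 \<le> x j" for j using T by (simp add: x_def)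
      have split: "integral {0..x m} f = (\<Sum>j<m. integral {x j..x (Suc j)} f)" if "m \<le> n" for m
        using that
      proof (induction m)
        case (Suc m)
        have "integral {0..x (Suc m)} f = integral {0..x m} f + integral {x m..x (Suc m)} f"
          using Suc.prems xs[of m] Tn x0[of m] xr[of "Suc m"]
          by (intro Henstock_Kurzweil_Integration.integral_combine[symmetric] int) auto
        with Suc show ?case by simp
      qed (simp add: x_def)
      have xn: "x n = T" using n0 by (simp add: x_def)
      have piece: "\<bar>T / real n * f (x j) - integral {x j..x (Suc j)} f\<bar> \<le> e' * (T / real n)"
        if "j < n" for j
      proof -
        have j: "0 \<le> x j" "x (Suc j) \<le> T" using x0 xr[of "Suc j"] that by auto
        have "integral {x j..x (Suc j)} (\<lambda>t. f (x j) - f t)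
             = T / real n * f (x j) - integral {x j..x (Suc j)} f"
          using xs[of j] Tn(2) int[OF j]
          by (subst Henstock_Kurzweil_Integration.integral_diff) auto
        moreover have "norm (integral {x j..x (Suc j)} (\<lambda>t. f (x j) - f t)) \<le> e' * (x (Suc j) - x j)"
        proof (rule integral_bound)
          show "x j \<le> x (Suc j)" using xs[of j] Tn by linarith
          show "continuous_on {x j..x (Suc j)} (\<lambda>t. f (x j) - f t)"
            using j by (intro continuous_intros continuous_on_subset[OF cont]) auto
          fix t assume t: "t \<in> {x j..x (Suc j)}"
          then have "dist (x j) t < d" using xs[of j] Tn by (auto simp: dist_real_def)
          then have "dist (f (x j)) (f t) < e'" using t j by (intro d(2)) auto
          then show "norm (f (x j) - f t) \<le> e'" by (simp add: dist_norm)
        qed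
        ultimately show ?thesis using xs[of j] by simp
      qed
      have "T / real n * (\<Sum>j<n. f (x j)) - integral {0..T} f
          = (\<Sum>j<n. T / real n * f (x j) - integral {x j..x (Suc j)} f)"
        using split[of n] xn by (simp add: sum_subtractf sum_distrib_left)
      also have "\<bar>\<dots>\<bar> \<le> (\<Sum>j<n. e' * (T / real n))"
        by (intro order_trans[OF sum_abs] sum_mono piece) auto
      also have "\<dots> = e / 2" using n0 T by (simp add: e'_def field_simps)
      finally show "dist (T / real n * (\<Sum>j<n. f (T * real j / real n))) (integral {0..T} f) < e"
        using e by (simp add: dist_real_def x_def)
    qed
  qed
qed simp

text \<open>The sum of the nonpositive roots of the quartic for \<open>y = 2 * cos t\<close>, the
  only combination of \<open>wg_alpha\<close> and \<open>wg_beta\<close> that enters the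
  energies.\<close>

definition wg_h :: "real \<Rightarrow> real" where
  "wg_h t = wg_alpha (2 * cos t) + wg_beta (2 * cos t)"

lemma continuous_on_wg_h: "continuous_on S wg_h"
  unfolding wg_h_def
  by (intro continuous_intros continuous_on_compose2[OF wg_alpha_integral(1)]
      continuous_on_compose2[OF wg_beta_integral(1)]) auto

text \<open>The summand \<open>- wg_alpha (-2)\<close> of \<open>wg_L\<close> cancels the boundary
  term of \<open>wg_alpha_integral\<close>; the two remaining integrals combine.\<close>

lemma wg_L_eq_integral: "wg_L = 1 - integral {0..pi} wg_h / pi"
proof -
  have "(\<lambda>t. wg_alpha (2 * cos t)) integrable_on {0..pi}"
    "(\<lambda>t. wg_beta (2 * cos t)) integrable_on {0..pi}"
    by (intro integrable_continuous_interval continuous_intros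
      continuous_on_compose2[OF wg_alpha_integral(1)]
      continuous_on_compose2[OF wg_beta_integral(1)]; auto)+
  then have "integral {0..pi} wg_h = integral {0..pi} (\<lambda>t. wg_alpha (2 * cos t))
    + integral {0..pi} (\<lambda>t. wg_beta (2 * cos t))"
    unfolding wg_h_def by (rule Henstock_Kurzweil_Integration.integral_add)
  then show ?thesis
    unfolding wg_L_def wg_alpha_integral wg_beta_integral by (simp add: field_simps)
qed

text \<open>\<open>wg_h\<close> is even and \<open>2 * pi\<close>-periodic. This reconciles the
  cycle, whose angles fill a full turn, with the path, whose angles fill half of one.\<close>

lemma integral_wg_h_double: "integral {0..2 * pi} wg_h = 2 * integral {0..pi} wg_h"
proof -
  have "integral {0..pi} wg_h + integral {pi..2 * pi} wg_h = integral {0..2 * pi} wg_h"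
    by (intro Henstock_Kurzweil_Integration.integral_combine
        integrable_continuous_interval continuous_on_wg_h) auto
  moreover have "integral {pi..2 * pi} wg_h = integral {0..pi} wg_h"
  proof -
    have "wg_h (x + 2 * pi) = wg_h x" "wg_h (- x) = wg_h x" for x by (simp_all add: wg_h_def)
    then have "integral {0..pi} wg_h = integral {-pi..0} (\<lambda>x. wg_h (x + 2 * pi))"
      using Henstock_Kurzweil_Integration.integral_reflect_real[of pi 0 wg_h] by simp
    also have "\<dots> = integral {pi..2 * pi} wg_h"
      using integral_shift_real_ivl[of pi "2 * pi" "2 * pi" wg_h] by simp
    finally show ?thesis by simp
  qed
  ultimately show ?thesis by simp
qed

subsection \<open>Characteristic polynomials\<close>

text \<open>The energy as a function of the characteristic polynomial. In this form it is additive
  over products, so it can be read off from a factorization.\<close>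

definition root_abs_sum :: "real poly \<Rightarrow> real" where
  "root_abs_sum p = (\<Sum>x | poly p x = 0. real (Polynomial.order x p) * \<bar>x\<bar>)"

lemma root_abs_sum_superset:
  assumes "p \<noteq> 0" "finite S" "{x. poly p x = 0} \<subseteq> S"
  shows "root_abs_sum p = (\<Sum>x\<in>S. real (Polynomial.order x p) * \<bar>x\<bar>)"
  unfolding root_abs_sum_def
  by (rule sum.mono_neutral_left) (use assms in \<open>auto simp: order_root\<close>)

lemma root_abs_sum_mult:
  assumes "p \<noteq> 0" "q \<noteq> 0"
  shows "root_abs_sum (p * q) = root_abs_sum p + root_abs_sum q"
proof -
  define S where "S = {x. poly (p * q) x = 0}"
  have "p * q \<noteq> 0" using assms by simp
  then have S: "finite S" unfolding S_def by (rule poly_roots_finite)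
  have "root_abs_sum (p * q) = (\<Sum>x\<in>S. real (Polynomial.order x (p * q)) * \<bar>x\<bar>)"
    by (rule root_abs_sum_superset) (use assms S in \<open>auto simp: S_def\<close>)
  also have "\<dots> = (\<Sum>x\<in>S. real (Polynomial.order x p) * \<bar>x\<bar>) + (\<Sum>x\<in>S. real (Polynomial.order x q) * \<bar>x\<bar>)"
    using \<open>p * q \<noteq> 0\<close> by (simp add: order_mult distrib_right sum.distrib)
  also have "\<dots> = root_abs_sum p + root_abs_sum q"
    using assms S by (subst (1 2) root_abs_sum_superset[where S = S]) (auto simp: S_def)
  finally show ?thesis .
qed

lemma root_abs_sum_linear [simp]: "root_abs_sum [:a, 1:] = \<bar>a\<bar>"
proof -
  have "Polynomial.order (-a) [:a, 1:] = 1"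
    using order_power_n_n[of "-a" 1] by simp
  moreover have "{x. poly [:a, 1:] x = 0} = {-a}" by (auto simp: add_eq_0_iff)
  ultimately show ?thesis by (simp add: root_abs_sum_def)
qed

lemma root_abs_sum_prod:
  assumes "\<And>i. i \<in> I \<Longrightarrow> p i \<noteq> 0"
  shows "root_abs_sum (\<Prod>i\<in>I. p i) = (\<Sum>i\<in>I. root_abs_sum (p i))"
  using assms
proof (induction I rule: infinite_finite_induct)
  case (insert i I)
  then show ?case by (subst prod.insert) (auto simp: root_abs_sum_mult)
qed (simp_all add: root_abs_sum_def)

lemma root_abs_sum_power:
  assumes "p \<noteq> 0"
  shows "root_abs_sum (p ^ k) = real k * root_abs_sum p"
  using root_abs_sum_prod[of "{..<k}" "\<lambda>_. p"] assms by simp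

lemma root_abs_sum_wg_Q:
  assumes "y \<in> {-2..2}"
  shows "root_abs_sum (wg_Q y) = 1 - 2 * (wg_alpha y + wg_beta y)"
proof -
  obtain c d where *: "wg_alpha y < -1" "-1 < wg_beta y" "wg_beta y \<le> 0" "0 < c" "2 < d"
    "wg_Q y = [:-wg_alpha y, 1:] * [:-wg_beta y, 1:] * [:-c, 1:] * [:-d, 1:]"
    "wg_alpha y + wg_beta y + c + d = 1"
    using wg_alpha_wg_beta_factorization[OF assms] by metis
  have "root_abs_sum (wg_Q y) = \<bar>wg_alpha y\<bar> + \<bar>wg_beta y\<bar> + \<bar>c\<bar> + \<bar>d\<bar>"
    unfolding *(6)
    by (simp only: root_abs_sum_mult mult_eq_0_iff pCons_eq_0_iff one_neq_zero simp_thms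
        root_abs_sum_linear abs_minus_cancel)
  also have "\<dots> = - wg_alpha y - wg_beta y + c + d" using *(1-5) by simp
  finally show ?thesis using *(7) by simp
qed

lemma graph_energy_eq_root_abs_sum:
  "graph_energy G = root_abs_sum (char_poly (adjacency_matrix G))"
proof -
  have "adjacency_matrix G \<in> carrier_mat (fst G) (fst G)"
    by (simp add: adjacency_matrix_def)
  then have "Collect (eigenvalue (adjacency_matrix G)) = {x. poly (char_poly (adjacency_matrix G)) x = 0}"
    by (auto simp: eigenvalue_root_char_poly)
  then show ?thesis
    unfolding graph_energy_def root_abs_sum_def by simp
qed

section \<open>Characteristic polynomials from a divisor and enough eigenvalues\<close>

text \<open>Subtracting row \<open>s j\<close> from row \<open>t j\<close> leaves the determinant
  unchanged and makes row \<open>t j\<close> divisible by \<open>d\<close>. No row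
  \<open>s i\<close> is among the rows \<open>t j\<close>, so the other differences survive and
  induction extracts one factor per \<open>j\<close>. It yields the multiplicity of the eigenvalue
  -1.\<close>

lemma power_dvd_det_of_row_differences:
  fixes A :: "'a::comm_ring_1 Matrix.mat"
  assumes "A \<in> carrier_mat n n"
    and "\<And>j. j < k \<Longrightarrow> s j < n \<and> t j < n"
    and "inj_on t {..<k}" and "\<And>i j. i < k \<Longrightarrow> j < k \<Longrightarrow> s i \<noteq> t j"
    and "\<And>j c. j < k \<Longrightarrow> c < n \<Longrightarrow> d dvd A $$ (t j, c) - A $$ (s j, c)"
  shows "d ^ k dvd Determinant.det A"
  using assms
proof (induction k arbitrary: A)
  case (Suc k)
  have k: "s k < n" "t k < n" "s k \<noteq> t k" using Suc.prems(2,4) by auto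
  have "\<forall>c<n. \<exists>q. A $$ (t k, c) - A $$ (s k, c) = d * q"
    using Suc.prems(5)[of k] unfolding dvd_def by simp
  then obtain q where q: "\<And>c. c < n \<Longrightarrow> A $$ (t k, c) - A $$ (s k, c) = d * q c"
    by metis
  \<comment> \<open>Row \<open>t k\<close> of \<open>B\<close> is the quotient of the row difference
    by \<open>d\<close>, so that the determinant of \<open>A\<close> is \<open>d\<close> times that
    of \<open>B\<close>.\<close>
  define B where "B = Matrix.mat n n (\<lambda>(i, c). if i = t k then q c else A $$ (i, c))"
  have B: "B \<in> carrier_mat n n" by (simp add: B_def)
  have "addrow (-1) (t k) (s k) A = multrow (t k) d B"
    by (rule eq_matI) (use Suc.prems(1) k in \<open>auto simp: B_def q[symmetric]\<close>)
  then have "Determinant.det A = d * Determinant.det B"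
    using det_addrow[of "s k" n "t k" A "-1"] det_multrow[of "t k" n B d] k B Suc.prems(1) by simp
  moreover have "d ^ k dvd Determinant.det B"
  proof (rule Suc.IH[OF B])
    show "inj_on t {..<k}" using Suc.prems(3) by (rule inj_on_subset) auto
    fix j c assume "j < k" "c < n"
    moreover from this have "t j \<noteq> t k" "s j \<noteq> t k"
      using inj_onD[OF Suc.prems(3), of j k] Suc.prems(4)[of j k] by auto
    ultimately show "d dvd B $$ (t j, c) - B $$ (s j, c)"
      using Suc.prems(2)[of j] Suc.prems(5)[of j c] by (simp add: B_def)
  qed (use Suc.prems in auto)
  ultimately show ?case by (simp add: mult_dvd_mono)
qed simp

lemma poly_wg_Q_of_real:
  "poly (wg_Q (of_real y)) (of_real x :: 'a::{real_algebra_1,comm_ring_1}) = of_real (poly (wg_Q y) x)"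
  by (simp add: poly_wg_Q)

lemma monic_prod_wg_Q:
  fixes Y :: "real set"
  shows "degree (\<Prod>y\<in>Y. wg_Q (of_real y) :: 'a::real_field poly) = 4 * card Y"
    "lead_coeff (\<Prod>y\<in>Y. wg_Q (of_real y) :: 'a::real_field poly) = 1"
proof -
  have nz: "wg_Q a \<noteq> 0" for a :: 'a by (metis degree_0 degree_wg_Q zero_neq_numeral)
  show "degree (\<Prod>y\<in>Y. wg_Q (of_real y) :: 'a poly) = 4 * card Y"
    using nz by (subst degree_prod_eq_sum_degree) auto
  show "lead_coeff (\<Prod>y\<in>Y. wg_Q (of_real y) :: 'a poly) = 1"
    by (simp add: lead_coeff_prod)
qed

text \<open>Distinct values \<open>y\<close> have disjoint root sets, so the prescribed eigenvalues other than
  \<open>-1\<close> are as many as the degree leaves room for.\<close>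

lemma char_poly_eq_prod_wg_Q:
  fixes A :: "'a::real_field Matrix.mat" and Y Z :: "real set"
  assumes A: "A \<in> carrier_mat n n" and n: "n = k + card Z + 4 * card Y"
    and dvd: "[:1, 1:] ^ k dvd char_poly A"
    and Y: "finite Y" "Y \<subseteq> {-2..2}"
    and Z: "finite Z" "-1 \<notin> Z" "\<And>y z. y \<in> Y \<Longrightarrow> z \<in> Z \<Longrightarrow> poly (wg_Q y) z \<noteq> 0"
    and ev: "\<And>y x. y \<in> Y \<Longrightarrow> poly (wg_Q y) x = 0 \<Longrightarrow> eigenvalue A (of_real x)"
    and evZ: "\<And>z. z \<in> Z \<Longrightarrow> eigenvalue A (of_real z)"
  shows "char_poly A = [:1, 1:] ^ k * ((\<Prod>z\<in>Z. [:- of_real z, 1:]) * (\<Prod>y\<in>Y. wg_Q (of_real y)))"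
proof -
  obtain q where q: "char_poly A = [:1, 1:] ^ k * q" using dvd by (auto elim: dvdE)
  define P :: "'a poly" where "P = (\<Prod>z\<in>Z. [:- of_real z, 1:]) * (\<Prod>y\<in>Y. wg_Q (of_real y))"
  have cp: "degree (char_poly A) = n" "lead_coeff (char_poly A) = 1"
    using degree_monic_char_poly[OF A] by auto
  then have q0: "q \<noteq> 0" using q by auto
  have l: "degree ([:1, 1:] ^ k :: 'a poly) = k" "lead_coeff ([:1, 1:] ^ k :: 'a poly) = 1"
    by (simp add: degree_power_eq) (subst lead_coeff_power, simp)
  have dq: "degree q = card Z + 4 * card Y"
    using cp(1) n q0 unfolding q by (subst (asm) degree_mult_eq) (auto simp: l)
  have lq: "lead_coeff q = 1" using cp(2) unfolding q lead_coeff_mult l(2) by simp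
  have lZ: "degree (\<Prod>z\<in>Z. [:- of_real z, 1:] :: 'a poly) = card Z"
    by (subst degree_prod_eq_sum_degree) auto
  have lcZ: "lead_coeff (\<Prod>z\<in>Z. [:- of_real z, 1:] :: 'a poly) = 1"
    by (simp add: lead_coeff_prod)
  have dP: "degree P = card Z + 4 * card Y"
    unfolding P_def using lcZ lZ monic_prod_wg_Q[of Y, where 'a = 'a]
    by (subst degree_mult_eq) auto
  have lP: "lead_coeff P = 1"
    unfolding P_def lead_coeff_mult lcZ monic_prod_wg_Q(2) by simp
  define R where "R y = {x. poly (wg_Q y) x = 0}" for y :: real
  have R: "finite (R y) \<and> card (R y) = 4" if y: "y \<in> Y" for y
  proof -
    have "y \<in> {-2..2}" using y Y by auto
    then obtain c d where *: "wg_alpha y < -1" "-1 < wg_beta y" "wg_beta y \<le> 0" "0 < c" "2 < d"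
      "wg_Q y = [:-wg_alpha y, 1:] * [:-wg_beta y, 1:] * [:-c, 1:] * [:-d, 1:]" "c \<noteq> d"
      using wg_alpha_wg_beta_factorization by metis
    have "R y = {wg_alpha y, wg_beta y, c, d}"
      unfolding R_def *(6) poly_four_linear_factors by auto
    then show ?thesis using *(1-5,7) by auto
  qed
  \<comment> \<open>A common root is neither -1 nor 2, so it recovers both values as
    \<open>wg_F x\<close>.\<close>
  have disj: "R y \<inter> R y' = {}" if "y \<noteq> y'" for y y'
  proof (rule ccontr)
    assume "R y \<inter> R y' \<noteq> {}"
    then obtain x where x: "poly (wg_Q y) x = 0" "poly (wg_Q y') x = 0" unfolding R_def by auto
    then have "x \<noteq> -1" "x \<noteq> 2" using poly_wg_Q_nonzero by metis+
    then show False using x that wg_F_eq_iff by metis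
  qed
  define S where "S = Z \<union> (\<Union>y\<in>Y. R y)"
  have cS: "card S = card Z + 4 * card Y"
  proof -
    have "card (\<Union>y\<in>Y. R y) = (\<Sum>y\<in>Y. card (R y))"
      by (rule card_UN_disjoint) (use Y R disj in auto)
    also have "\<dots> = 4 * card Y" using R by simp
    finally have "card (\<Union>y\<in>Y. R y) = 4 * card Y" .
    moreover have "Z \<inter> (\<Union>y\<in>Y. R y) = {}" using Z(3) by (auto simp: R_def)
    ultimately show ?thesis
      unfolding S_def using Z(1) Y(1) R by (subst card_Un_disjoint) auto
  qed
  \<comment> \<open>Both are monic of the same degree and vanish on \<open>S\<close>, which has as
    many points as that degree. A point of \<open>S\<close> differs from -1, so it is
    \<open>q\<close>, not the power of \<open>[:1, 1:]\<close>, that vanishes there.\<close>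
  have "q = P"
  proof (rule poly_eqI_degree_lead_coeff[where n = "card Z + 4 * card Y" and A = "of_real ` S"])
    show "coeff q (card Z + 4 * card Y) = coeff P (card Z + 4 * card Y)"
      using dq dP lq lP by simp
    show "card Z + 4 * card Y \<le> card (of_real ` S :: 'a set)"
      using cS by (subst card_image) (auto simp: inj_on_def)
    show "degree q \<le> card Z + 4 * card Y" "degree P \<le> card Z + 4 * card Y" using dq dP by auto
    fix w :: 'a assume "w \<in> of_real ` S"
    then obtain x where x: "x \<in> S" "w = of_real x" by auto
    have "eigenvalue A w" "x \<noteq> -1"
      using x ev evZ Z(2) poly_wg_Q_nonzero(1) by (auto simp: S_def R_def)
    then have "poly (char_poly A) w = 0" "w \<noteq> -1"
      using eigenvalue_root_char_poly[OF A] x(2) of_real_eq_iff[of x "-1", where 'a = 'a] by simp_all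
    moreover from this(2) have "1 + w \<noteq> 0" by (metis add.commute eq_neg_iff_add_eq_0)
    ultimately have "poly q w = 0" unfolding q by simp
    moreover have "poly P w = 0"
    proof -
      consider "x \<in> Z" | y where "y \<in> Y" "poly (wg_Q y) x = 0"
        using x unfolding S_def R_def by auto
      then show ?thesis
      proof cases
        case 1
        then have "(\<Prod>z\<in>Z. poly [:- of_real z, 1:] w) = 0" using Z(1) x(2) by force
        then show ?thesis unfolding P_def by (simp add: poly_prod)
      next
        case 2
        then have "poly (wg_Q (of_real y)) w = 0" by (simp add: x(2) poly_wg_Q_of_real)
        then have "(\<Prod>y\<in>Y. poly (wg_Q (of_real y)) w) = 0" using Y(1) 2 by auto
        then show ?thesis unfolding P_def by (simp add: poly_prod)
      qed
    qed
    ultimately show "poly q w = poly P w" by simp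
  qed
  then show ?thesis unfolding q P_def by simp
qed

text \<open>The Leibniz formula evaluated at \<open>x\<close>. It exhibits the value as a polynomial
  in the matrix entries, which makes it continuous in them.\<close>

lemma poly_char_poly_expansion:
  fixes A :: "'a::comm_ring_1 Matrix.mat"
  assumes A: "A \<in> carrier_mat n n"
  shows "poly (char_poly A) x = (\<Sum>p | p permutes {0..<n}. signof p *
    (\<Prod>i = 0..<n. (if i = p i then x else 0) - A $$ (i, p i)))"
proof -
  have "poly (char_poly_matrix A $$ (i, p i)) x = (if i = p i then x else 0) - A $$ (i, p i)"
    if "p permutes {0..<n}" "i < n" for p i
    using that A permutes_in_image[of p "{0..<n}" i] by (auto simp: char_poly_matrix_def)
  moreover have "poly (signof p :: 'a poly) x = signof p" for p :: "nat \<Rightarrow> nat"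
    by (auto simp: sign_def)
  ultimately show ?thesis
    unfolding char_poly_def det_def'[OF char_poly_matrix_closed[OF A]]
    by (simp add: poly_sum poly_prod)
qed

lemma tendsto_poly_char_poly:
  fixes A :: "'b \<Rightarrow> 'a::real_normed_field Matrix.mat"
  assumes "\<And>t. A t \<in> carrier_mat n n" "B \<in> carrier_mat n n"
    and "\<And>i j. i < n \<Longrightarrow> j < n \<Longrightarrow> ((\<lambda>t. A t $$ (i, j)) \<longlongrightarrow> B $$ (i, j)) F"
  shows "((\<lambda>t. poly (char_poly (A t)) x) \<longlongrightarrow> poly (char_poly B) x) F"
  unfolding poly_char_poly_expansion[OF assms(1)] poly_char_poly_expansion[OF assms(2)]
  by (intro tendsto_intros assms(3)) (use permutes_in_image in fastforce)+

subsection \<open>Wine glass graphs\<close>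

text \<open>A matching takes at most one edge from each class \<open>C i\<close>, since the edges of
  a class meet pairwise. The disjoint representatives \<open>m i\<close> attain the bound.\<close>

lemma matching_number_eqI:
  assumes G: "snd G = (\<Union>i\<in>I. C i)" and I: "finite I" and fin: "\<And>i. i \<in> I \<Longrightarrow> finite (C i)"
    and meet: "\<And>i e f. i \<in> I \<Longrightarrow> e \<in> C i \<Longrightarrow> f \<in> C i \<Longrightarrow> e \<inter> f \<noteq> {}"
    and m: "\<And>i. i \<in> I \<Longrightarrow> m i \<in> C i"
    and disj: "\<And>i j. i \<in> I \<Longrightarrow> j \<in> I \<Longrightarrow> i \<noteq> j \<Longrightarrow> m i \<inter> m j = {}"
  shows "matching_number G = card I"
  unfolding matching_number_def
proof (rule Max_eqI)
  have "finite (snd G)" using G I fin by auto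
  then have "finite {M. matching G M}"
    by (rule finite_subset[rotated, OF finite_Pow_iff[THEN iffD2]]) (auto simp: matching_def)
  then show "finite (card ` {M. matching G M})" by simp
  \<comment> \<open>Taking \<open>e = f\<close> in \<open>meet\<close> shows that edges are
    nonempty, so disjoint representatives are distinct.\<close>
  have ne: "m i \<noteq> {}" if "i \<in> I" for i using meet[OF that m m] that by auto
  have "inj_on m I"
  proof (rule inj_onI)
    fix i j assume "i \<in> I" "j \<in> I" "m i = m j"
    then show "i = j" using disj[of i j] ne[of i] by auto
  qed
  then have "card (m ` I) = card I" by (rule card_image)
  moreover have "matching G (m ` I)"
    unfolding matching_def
  proof (intro conjI ballI impI)
    show "m ` I \<subseteq> snd G" using G m by blast
    fix e f assume "e \<in> m ` I" "f \<in> m ` I" "e \<noteq> f"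
    then show "e \<inter> f = {}" using disj by blast
  qed
  ultimately show "card I \<in> card ` {M. matching G M}" by force
  fix n assume "n \<in> card ` {M. matching G M}"
  then obtain M where M: "matching G M" "n = card M" by auto
  have "\<forall>e\<in>M. \<exists>i\<in>I. e \<in> C i" using M(1) G unfolding matching_def by auto
  then obtain h where h: "\<And>e. e \<in> M \<Longrightarrow> h e \<in> I \<and> e \<in> C (h e)" by metis
  have "inj_on h M"
  proof (rule inj_onI)
    fix e f assume "e \<in> M" "f \<in> M" "h e = h f"
    then show "e = f" using h[of e] h[of f] meet[of "h e" e f] M(1) unfolding matching_def by metis
  qed
  then have "card M \<le> card I" by (rule card_inj_on_le) (use h I in auto)
  with M show "n \<le> card I" by simp
qed

text \<open>The map \<open>nx\<close> gives the index of the second p-neighbour of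
  \<open>vq j\<close>. With \<open>Suc\<close> this is the path, with \<open>Suc\<close> modulo
  \<open>k\<close> the cycle, so both graphs are handled together.\<close>

definition wg_edges :: "nat \<Rightarrow> (nat \<Rightarrow> nat) \<Rightarrow> nat set set" where
  "wg_edges k nx = (\<Union>j<k. {{vp j, vq j}, {vq j, vp (nx j)}, {vq j, vr j},
     {vr j, vs j}, {vr j, vt j}, {vs j, vt j}})"

lemma wine_glass_path_eq: "wine_glass_path k = (5 * k + 1, wg_edges k Suc)"
  by (simp add: wine_glass_path_def wg_edges_def)

lemma wine_glass_cycle_eq: "wine_glass_cycle k = (5 * k, wg_edges k (\<lambda>j. Suc j mod k))"
  by (simp add: wine_glass_cycle_def wg_edges_def)

lemma vertex_eq_iff [simp]:
  "vp i = vp j \<longleftrightarrow> i = j" "vq i = vq j \<longleftrightarrow> i = j" "vr i = vr j \<longleftrightarrow> i = j"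
  "vs i = vs j \<longleftrightarrow> i = j" "vt i = vt j \<longleftrightarrow> i = j"
  by (auto simp: vp_def vq_def vr_def vs_def vt_def)

lemma vertex_mod_div [simp]:
  "vp j mod 5 = 0" "vq j mod 5 = 1" "vr j mod 5 = 2" "vs j mod 5 = 3" "vt j mod 5 = 4"
  "vp j div 5 = j" "vq j div 5 = j" "vr j div 5 = j" "vs j div 5 = j" "vt j div 5 = j"
  by (simp_all add: vp_def vq_def vr_def vs_def vt_def mod_Suc)

lemma vertex_neq [simp]:
  "vp i \<noteq> vq j" "vp i \<noteq> vr j" "vp i \<noteq> vs j" "vp i \<noteq> vt j"
  "vq i \<noteq> vp j" "vq i \<noteq> vr j" "vq i \<noteq> vs j" "vq i \<noteq> vt j"
  "vr i \<noteq> vp j" "vr i \<noteq> vq j" "vr i \<noteq> vs j" "vr i \<noteq> vt j"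
  "vs i \<noteq> vp j" "vs i \<noteq> vq j" "vs i \<noteq> vr j" "vs i \<noteq> vt j"
  "vt i \<noteq> vp j" "vt i \<noteq> vq j" "vt i \<noteq> vr j" "vt i \<noteq> vs j"
  by (rule notI, drule arg_cong[where f = "\<lambda>i. i mod 5"], simp)+

text \<open>Each of the \<open>k\<close> blocks splits into the star at \<open>vq j\<close> and the
  triangle on \<open>vr j\<close>, \<open>vs j\<close>, \<open>vt j\<close>. The edges of either
  meet pairwise, and \<open>vp j\<close>-\<open>vq j\<close> and
  \<open>vr j\<close>-\<open>vs j\<close> serve as representatives.\<close>

lemma matching_number_wg_edges: "matching_number (n, wg_edges k nx) = 2 * k"
proof -
  define C where "C = (\<lambda>(j, b). if b then {{vp j, vq j}, {vq j, vp (nx j)}, {vq j, vr j}}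
    else {{vr j, vs j}, {vr j, vt j}, {vs j, vt j}})"
  define m where "m = (\<lambda>(j, b). if b then {vp j, vq j} else {vr j, vs j})"
  have "matching_number (n, wg_edges k nx) = card ({..<k} \<times> (UNIV :: bool set))"
  proof (rule matching_number_eqI[where C = C and m = m])
    have "(\<Union>i\<in>{..<k} \<times> UNIV. C i) = (\<Union>j<k. C (j, True) \<union> C (j, False))"
    proof (intro equalityI subsetI)
      fix e assume "e \<in> (\<Union>i\<in>{..<k} \<times> UNIV. C i)"
      then obtain j b where "j < k" "e \<in> C (j, b)" by auto
      then show "e \<in> (\<Union>j<k. C (j, True) \<union> C (j, False))" by (cases b) auto
    qed auto
    moreover have "wg_edges k nx = (\<Union>j<k. C (j, True) \<union> C (j, False))"
      unfolding wg_edges_def C_def by (rule SUP_cong) auto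
    ultimately show "snd (n, wg_edges k nx) = (\<Union>i\<in>{..<k} \<times> UNIV. C i)" by simp
    show "finite (C i)" for i by (cases i) (simp add: C_def)
    show "e \<inter> f \<noteq> {}" if "e \<in> C i" "f \<in> C i" for i e f
    proof (cases i)
      case (Pair j b)
      with that show ?thesis by (cases b) (simp_all add: C_def, (elim disjE; simp)+)
    qed
    show "m i \<in> C i" for i by (cases i) (simp add: C_def m_def)
    show "m i \<inter> m j = {}" if "i \<noteq> j" for i j
      using that by (cases i; cases j; cases "snd i"; cases "snd j") (simp_all add: m_def)
  qed simp
  then show ?thesis by (simp add: card_cartesian_product)
qed

section \<open>Weighted adjacency matrices and their eigenvectors\<close>

lemma wg_edges_iff:
  "{vp j, c} \<in> wg_edges k nx \<longleftrightarrow> j < k \<and> c = vq j \<or> (\<exists>i<k. nx i = j \<and> c = vq i)"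
  "j < k \<Longrightarrow> {vq j, c} \<in> wg_edges k nx \<longleftrightarrow> c = vp j \<or> c = vp (nx j) \<or> c = vr j"
  "j < k \<Longrightarrow> {vr j, c} \<in> wg_edges k nx \<longleftrightarrow> c = vq j \<or> c = vs j \<or> c = vt j"
  "j < k \<Longrightarrow> {vs j, c} \<in> wg_edges k nx \<longleftrightarrow> c = vr j \<or> c = vt j"
  "j < k \<Longrightarrow> {vt j, c} \<in> wg_edges k nx \<longleftrightarrow> c = vr j \<or> c = vs j"
  unfolding wg_edges_def by (auto simp: doubleton_eq_iff)

text \<open>The edges \<open>q\<^sub>j p\<^sub>i\<close> with \<open>i = nx j\<close> get the weight \<open>u\<close> in direction \<open>q\<^sub>j\<close> to \<open>p\<^sub>i\<close> and
  \<open>u'\<close> in the opposite direction.\<close>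

definition wg_weight :: "'a::field \<Rightarrow> 'a \<Rightarrow> nat \<Rightarrow> nat \<Rightarrow> 'a" where
  "wg_weight u u' i c =
    (if i mod 5 = 1 \<and> c mod 5 = 0 \<and> c div 5 \<noteq> i div 5 then u
     else if i mod 5 = 0 \<and> c mod 5 = 1 \<and> c div 5 \<noteq> i div 5 then u' else 1)"

text \<open>Which case applies depends only on the position, not on the weights. Hence each entry
  converges when the weights do.\<close>

lemma wg_weight_cases:
  "(\<forall>u u' :: 'a::field. wg_weight u u' i c = u) \<or> (\<forall>u u' :: 'a. wg_weight u u' i c = u')
    \<or> (\<forall>u u' :: 'a. wg_weight u u' i c = 1)"
proof -
  let ?A = "i mod 5 = 1 \<and> c mod 5 = 0 \<and> c div 5 \<noteq> i div 5"
  let ?B = "i mod 5 = 0 \<and> c mod 5 = 1 \<and> c div 5 \<noteq> i div 5"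
  have "?thesis" if "\<And>u u' :: 'a. wg_weight u u' i c = (if P then u else if Q then u' else 1)" for P Q
    unfolding that by (cases P; cases Q; simp)
  from this[of ?A ?B] show ?thesis by (simp only: wg_weight_def)
qed

definition wg_mat :: "nat \<Rightarrow> nat \<Rightarrow> (nat \<Rightarrow> nat) \<Rightarrow> 'a::field \<Rightarrow> 'a \<Rightarrow> 'a Matrix.mat" where
  "wg_mat n k nx u u' =
    Matrix.mat n n (\<lambda>(i, c). if {i, c} \<in> wg_edges k nx then wg_weight u u' i c else 0)"

lemma wg_mat_carrier [simp]: "wg_mat n k nx u u' \<in> carrier_mat n n"
  by (simp add: wg_mat_def)

lemma adjacency_matrix_eq_wg_mat: "adjacency_matrix (n, wg_edges k nx) = wg_mat n k nx 1 1"
  by (simp add: adjacency_matrix_def wg_mat_def wg_weight_def cong: if_cong)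

text \<open>The vertices \<open>vs j\<close> and \<open>vt j\<close> are adjacent twins: their rows
  in the characteristic matrix differ only in their own two columns, by \<open>x + 1\<close> up to
  sign.\<close>

lemma power_dvd_char_poly_wg_mat:
  assumes "5 * k \<le> n"
  shows "[:1, 1:] ^ k dvd char_poly (wg_mat n k nx u u')"
  unfolding char_poly_def
proof (rule power_dvd_det_of_row_differences[where s = vs and t = vt])
  show "char_poly_matrix (wg_mat n k nx u u') \<in> carrier_mat n n" by simp
  show *: "vs j < n \<and> vt j < n" if "j < k" for j
    using that assms by (simp add: vs_def vt_def)
  show "inj_on vt {..<k}" by (auto simp: inj_on_def)
  fix j c assume j: "j < k" and c: "c < n"
  show "[:1, 1:] dvd char_poly_matrix (wg_mat n k nx u u') $$ (vt j, c)
    - char_poly_matrix (wg_mat n k nx u u') $$ (vs j, c)"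
    (is "_ dvd ?d")
  proof -
    have "?d = (if c = vt j then [:1, 1:] else if c = vs j then - [:1, 1:] else 0)"
      using *[OF j] c
      by (auto simp: char_poly_matrix_def wg_mat_def wg_edges_iff(4,5)[OF j] wg_weight_def one_pCons)
    then show ?thesis by (simp del: minus_pCons)
  qed
qed simp

lemma sum_wg_mat_row:
  assumes "{c. {i, c} \<in> wg_edges k nx} \<subseteq> {..<n}"
  shows "(\<Sum>c<n. (if {i, c} \<in> wg_edges k nx then wg_weight u u' i c else 0) * v c)
    = (\<Sum>c | {i, c} \<in> wg_edges k nx. wg_weight u u' i c * v c)"
proof -
  have "(\<Sum>c | {i, c} \<in> wg_edges k nx. wg_weight u u' i c * v c)
    = (\<Sum>c<n. if {i, c} \<in> wg_edges k nx then wg_weight u u' i c * v c else 0)"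
    using assms by (intro sum.mono_neutral_cong_left) auto
  then show ?thesis by (simp add: if_distrib[of "\<lambda>x. x * _"] cong: if_cong)
qed

text \<open>These are the eigenvector equations row by row for a vector with the same value
  \<open>s j\<close> on \<open>vs j\<close> and \<open>vt j\<close>. The bound
  \<open>5 * j < n\<close> also covers the final vertex \<open>vp k\<close> of the path.\<close>

lemma eigenvalue_wg_matI:
  fixes x u u' :: "'a::field"
  assumes n: "n = 5 * k \<or> n = 5 * k + 1"
    and nx: "\<And>j. j < k \<Longrightarrow> nx j \<noteq> j \<and> 5 * nx j < n"
    and eqp: "\<And>j. 5 * j < n \<Longrightarrow> x * p j = (if j < k then q j else 0) + (\<Sum>i | i < k \<and> nx i = j. u' * q i)"
    and eqq: "\<And>j. j < k \<Longrightarrow> x * q j = p j + u * p (nx j) + r j"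
    and eqr: "\<And>j. j < k \<Longrightarrow> x * r j = q j + s j + s j"
    and eqs: "\<And>j. j < k \<Longrightarrow> x * s j = r j + s j"
    and nz: "(\<exists>j. 5 * j < n \<and> p j \<noteq> 0) \<or> (\<exists>j<k. s j \<noteq> 0)"
  shows "eigenvalue (wg_mat n k nx u u') x"
proof -
  define v where "v i = ([p, q, r, s, s] ! (i mod 5)) (i div 5)" for i
  have v: "v (vp j) = p j" "v (vq j) = q j" "v (vr j) = r j" "v (vs j) = s j" "v (vt j) = s j" for j
    by (simp_all add: v_def)
  have lt: "vp j < n" "vq j < n" "vr j < n" "vs j < n" "vt j < n" if "j < k" for j
    using that n by (auto simp: vp_def vq_def vr_def vs_def vt_def)
  have row: "(\<Sum>c<n. (if {i, c} \<in> wg_edges k nx then wg_weight u u' i c else 0) * v c) = x * v i"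
    if i: "i < n" for i
  proof -
    have nxn: "vp (nx j) < n" if "j < k" for j using nx[OF that] by (simp add: vp_def)
    define j where "j = i div 5"
    have "i = 5 * j \<or> i = 5 * j + 1 \<or> i = 5 * j + 2 \<or> i = 5 * j + 3 \<or> i = 5 * j + 4"
      unfolding j_def by presburger
    \<comment> \<open>Beyond the \<open>k\<close> full blocks there is at most the single vertex
      \<open>vp k\<close>.\<close>
    then have "i = vp j \<or> j < k \<and> (i = vq j \<or> i = vr j \<or> i = vs j \<or> i = vt j)"
      using n i by (auto simp: vp_def vq_def vr_def vs_def vt_def)
    then consider "i = vp j" | "j < k" "i = vq j" | "j < k" "i = vr j" | "j < k" "i = vs j"
      | "j < k" "i = vt j" by blast
    then show ?thesis
    proof cases
      case 1
      have N: "{c. {vp j, c} \<in> wg_edges k nx} = (if j < k then {vq j} else {}) \<union> vq ` {i. i < k \<and> nx i = j}"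
        unfolding wg_edges_iff by auto
      have "(\<Sum>c | {vp j, c} \<in> wg_edges k nx. wg_weight u u' (vp j) c * v c)
        = (if j < k then q j else 0) + (\<Sum>c\<in>vq ` {i. i < k \<and> nx i = j}. wg_weight u u' (vp j) c * v c)"
        unfolding N using nx[of j] by (subst sum.union_disjoint) (auto simp: v wg_weight_def)
      \<comment> \<open>As \<open>nx i \<noteq> i\<close>, these neighbours lie in another block, so
        their edges carry the weight \<open>u'\<close>.\<close>
      also have "(\<Sum>c\<in>vq ` {i. i < k \<and> nx i = j}. wg_weight u u' (vp j) c * v c)
        = (\<Sum>i | i < k \<and> nx i = j. u' * q i)"
        by (subst sum.reindex) (auto simp: inj_on_def v wg_weight_def intro!: sum.cong dest: nx)
      also have "(if j < k then q j else 0) + \<dots> = x * v i"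
        using eqp[of j] i 1 by (simp add: v) (simp add: vp_def)
      finally show ?thesis
        unfolding 1 by (subst sum_wg_mat_row) (auto simp: wg_edges_iff lt)
    next
      case 2
      have "{c. {vq j, c} \<in> wg_edges k nx} = {vp j, vp (nx j), vr j}"
        using 2 by (auto simp: wg_edges_iff)
      then show ?thesis
        unfolding 2(2) using 2(1) nx[of j] eqq[of j] nxn[of j]
        by (subst sum_wg_mat_row) (auto simp: wg_edges_iff lt v wg_weight_def add.assoc)
    next
      case 3
      have "{c. {vr j, c} \<in> wg_edges k nx} = {vq j, vs j, vt j}"
        using 3 by (auto simp: wg_edges_iff)
      then show ?thesis
        unfolding 3(2) using 3(1) eqr[of j]
        by (subst sum_wg_mat_row) (auto simp: wg_edges_iff lt v wg_weight_def add.assoc)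
    next
      case 4
      have "{c. {vs j, c} \<in> wg_edges k nx} = {vr j, vt j}"
        using 4 by (auto simp: wg_edges_iff)
      then show ?thesis
        unfolding 4(2) using 4(1) eqs[of j]
        by (subst sum_wg_mat_row) (auto simp: wg_edges_iff lt v wg_weight_def)
    next
      case 5
      have "{c. {vt j, c} \<in> wg_edges k nx} = {vr j, vs j}"
        using 5 by (auto simp: wg_edges_iff)
      then show ?thesis
        unfolding 5(2) using 5(1) eqs[of j]
        by (subst sum_wg_mat_row) (auto simp: wg_edges_iff lt v wg_weight_def)
    qed
  qed
  have "eigenvector (wg_mat n k nx u u') (Matrix.vec n v) x"
    unfolding eigenvector_def
  proof (intro conjI)
    show "Matrix.vec n v \<in> carrier_vec (dim_row (wg_mat n k nx u u'))" by (simp add: wg_mat_def)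
    obtain i where i: "i < n" "v i \<noteq> 0"
      using nz v(1,4) lt(4) by (metis vp_def)
    then have "Matrix.vec n v $ i \<noteq> (0\<^sub>v n) $ i" by simp
    then show "Matrix.vec n v \<noteq> 0\<^sub>v (dim_row (wg_mat n k nx u u'))"
      by (auto simp: wg_mat_def)
    show "wg_mat n k nx u u' *\<^sub>v Matrix.vec n v = x \<cdot>\<^sub>v Matrix.vec n v"
      by (rule eq_vecI) (simp_all add: wg_mat_def scalar_prod_def row[symmetric] atLeast0LessThan)
  qed
  then show ?thesis unfolding eigenvalue_def by blast
qed

text \<open>Eliminating p, r and s from the eigenvector equations leaves a relation between the
  q-values alone. With \<open>c\<close> proportional to these values, it is the wave equation with
  parameter \<open>y\<close>, and the quartic is the condition that matches \<open>x\<close> to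
  \<open>y\<close>.\<close>

lemma eigenvalue_wg_mat_of_wave:
  fixes x y u u' :: "'a::field" and c P :: "nat \<Rightarrow> 'a"
  assumes n: "n = 5 * k \<or> n = 5 * k + 1"
    and nx: "\<And>j. j < k \<Longrightarrow> nx j \<noteq> j \<and> 5 * nx j < n"
    and P: "\<And>j. 5 * j < n \<Longrightarrow> P j = (if j < k then c j else 0) + (\<Sum>i | i < k \<and> nx i = j. u' * c i)"
    and wave: "\<And>j. j < k \<Longrightarrow> P j + u * P (nx j) = (2 + y) * c j"
    and c: "l < k" "c l \<noteq> 0"
    and x: "poly (wg_Q y) x = 0" "x \<noteq> 0"
  shows "eigenvalue (wg_mat n k nx u u') x"
\<comment> \<open>Solve from \<open>s = x * c\<close> upwards: \<open>r = (x - 1) * s\<close> and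
  \<open>q = x * r - 2 * s\<close>, while \<open>x * p\<close> is the weighted sum of adjacent
  q-values. This scaling avoids all divisions.\<close>
proof (rule eigenvalue_wg_matI[OF n nx, where p = "\<lambda>j. (x - 2) * (x + 1) * P j"
    and q = "\<lambda>j. x * (x - 2) * (x + 1) * c j" and r = "\<lambda>j. x * (x - 1) * c j" and s = "\<lambda>j. x * c j"])
  have x': "(x + 1) * (x - 2) * (x\<^sup>2 - 3 - y) = 2" using x by (simp add: poly_wg_Q)
  show "x * ((x - 2) * (x + 1) * P j) = (if j < k then x * (x - 2) * (x + 1) * c j else 0) +
      (\<Sum>i | i < k \<and> nx i = j. u' * (x * (x - 2) * (x + 1) * c i))" if "5 * j < n" for j
  proof -
    have "(\<Sum>i | i < k \<and> nx i = j. u' * (x * (x - 2) * (x + 1) * c i))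
      = x * (x - 2) * (x + 1) * (\<Sum>i | i < k \<and> nx i = j. u' * c i)"
      by (simp add: sum_distrib_left mult_ac)
    then show ?thesis unfolding P[OF that] by (simp add: algebra_simps)
  qed
  show "x * (x * (x - 2) * (x + 1) * c j) =
      (x - 2) * (x + 1) * P j + u * ((x - 2) * (x + 1) * P (nx j)) + x * (x - 1) * c j" if "j < k" for j
  proof -
    have "(x - 2) * (x + 1) * P j + u * ((x - 2) * (x + 1) * P (nx j))
      = (x - 2) * (x + 1) * (P j + u * P (nx j))" by (simp add: algebra_simps)
    also have "\<dots> = (x - 2) * (x + 1) * (2 + y) * c j" unfolding wave[OF that] by simp
    also have "\<dots> + x * (x - 1) * c j = ((x - 2) * (x + 1) * (2 + y) + x * (x - 1)) * c j"
      by (simp add: algebra_simps)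
    \<comment> \<open>The two sides differ by the value of the quartic at \<open>x\<close>, which is
      0.\<close>
    also have "(x - 2) * (x + 1) * (2 + y) + x * (x - 1) = x * (x * (x - 2) * (x + 1))"
    proof -
      have "x * (x * (x - 2) * (x + 1)) - ((x - 2) * (x + 1) * (2 + y) + x * (x - 1))
        = (x + 1) * (x - 2) * (x\<^sup>2 - 3 - y) - 2"
        by (simp add: algebra_simps power2_eq_square)
      with x' show ?thesis by simp
    qed
    finally show ?thesis by (simp add: mult_ac)
  qed
  show "x * (x * (x - 1) * c j) = x * (x - 2) * (x + 1) * c j + x * c j + x * c j" for j
    by (simp add: algebra_simps)
  show "x * (x * c j) = x * (x - 1) * c j + x * c j" for j
    by (simp add: algebra_simps)
  show "(\<exists>j. 5 * j < n \<and> (x - 2) * (x + 1) * P j \<noteq> 0) \<or> (\<exists>j<k. x * c j \<noteq> 0)"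
    using c x(2) by (intro disjI2 exI[of _ l]) simp
qed

subsection \<open>Spectra of the wine glass path and cycle\<close>

text \<open>The wave eigenvectors require \<open>x \<noteq> 0\<close>, so it has to be known which
  \<open>y\<close> give the root 0.\<close>

lemma poly_wg_Q_zero_iff: "poly (wg_Q y) (0::real) = 0 \<longleftrightarrow> y = -2"
  by (auto simp: poly_wg_Q)

lemma pi_fraction_bounds:
  assumes "m \<in> {1..k}"
  shows "0 < pi * real m / (real k + 1)" "pi * real m / (real k + 1) < pi"
proof -
  show "0 < pi * real m / (real k + 1)" using assms by simp
  have "pi * real m < pi * (real k + 1)" using assms by (intro mult_strict_left_mono) auto
  then show "pi * real m / (real k + 1) < pi" by (simp add: pos_divide_less_eq)
qed

text \<open>The eigenvector is a standing wave that vanishes at the fictitious positions -1 and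
  \<open>k\<close>. Thus the end vertices \<open>vp 0\<close> and \<open>vp k\<close>, with one
  neighbour each, obey the same rule as the inner ones.\<close>

lemma eigenvalue_wg_path:
  fixes x :: real
  assumes m: "m \<in> {1..k}" and x: "poly (wg_Q (2 * cos (pi * real m / (real k + 1)))) x = 0" "x \<noteq> 0"
  shows "eigenvalue (wg_mat (5 * k + 1) k Suc 1 1) x"
proof -
  define \<phi> where "\<phi> = pi * real m / (real k + 1)"
  define c where "c j = sin (real (j + 1) * \<phi>)" for j
  \<comment> \<open>The second summand is the value of the wave at position \<open>j - 1\<close>,
    written so that it is 0 for \<open>j = 0\<close>.\<close>
  define P where "P j = c j + sin (real j * \<phi>)" for j
  have ck: "c k = 0"
  proof -
    have "real (k + 1) * \<phi> = pi * real m"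
      unfolding \<phi>_def by (simp add: nonzero_divide_eq_eq add.commute)
    then show ?thesis unfolding c_def by simp
  qed
  have "0 < \<phi>" "\<phi> < pi" unfolding \<phi>_def by (rule pi_fraction_bounds[OF m])+
  then have c0: "c 0 \<noteq> 0" using sin_gt_zero[of \<phi>] by (simp add: c_def)
  show ?thesis
  proof (rule eigenvalue_wg_mat_of_wave[where c = c and P = P and l = 0 and y = "2 * cos \<phi>"])
    show "P j = (if j < k then c j else 0) + (\<Sum>i | i < k \<and> Suc i = j. 1 * c i)"
      if "5 * j < 5 * k + 1" for j
    proof -
      have "(if j < k then c j else 0) = c j" using ck that by (cases "j = k") auto
      moreover have "(\<Sum>i | i < k \<and> Suc i = j. 1 * c i) = sin (real j * \<phi>)"
      proof (cases j)
        case (Suc i)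
        then have "{i. i < k \<and> Suc i = j} = {i}" using that by auto
        then show ?thesis by (simp add: c_def Suc)
      qed simp
      ultimately show ?thesis by (simp add: P_def)
    qed
    show "P j + 1 * P (Suc j) = (2 + 2 * cos \<phi>) * c j" for j
    proof -
      have "sin (real j * \<phi>) = sin (real (j + 1) * \<phi> - \<phi>)"
        "sin (real (Suc j + 1) * \<phi>) = sin (real (j + 1) * \<phi> + \<phi>)"
        by (simp_all add: algebra_simps)
      then have "sin (real j * \<phi>) + sin (real (Suc j + 1) * \<phi>) = 2 * cos \<phi> * sin (real (j + 1) * \<phi>)"
        by (simp only: sin_add sin_diff) (simp add: algebra_simps)
      then show ?thesis unfolding P_def c_def by (simp add: algebra_simps)
    qed
    show "poly (wg_Q (2 * cos \<phi>)) x = 0" using x(1) unfolding \<phi>_def .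
  qed (use m c0 x in auto)
qed

text \<open>Alternating signs on the p-vertices cancel at every q-vertex.\<close>

lemma eigenvalue_wg_path_zero: "eigenvalue (wg_mat (5 * k + 1) k Suc 1 1) (0::real)"
proof (rule eigenvalue_wg_matI[where p = "\<lambda>j. (-1) ^ j" and q = "\<lambda>_. 0" and r = "\<lambda>_. 0" and s = "\<lambda>_. 0"])
  show "(\<exists>j. 5 * j < 5 * k + 1 \<and> (-1 :: real) ^ j \<noteq> 0) \<or> (\<exists>j<k. (0::real) \<noteq> 0)"
    by (intro disjI1 exI[of _ 0]) simp
qed simp_all

text \<open>The angles lie strictly between 0 and pi, where the cosine is injective and differs from
  -1. So there are \<open>k\<close> distinct values of \<open>y\<close>, none of them -2, and
  \<open>k + 1 + 4 * k\<close> exhausts the dimension.\<close>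

lemma char_poly_wg_path:
  "char_poly (wg_mat (5 * k + 1) k Suc 1 1 :: real Matrix.mat)
     = [:1, 1:] ^ k * ([:0, 1:] * (\<Prod>m = 1..k. wg_Q (2 * cos (pi * real m / (real k + 1)))))"
proof -
  define f where "f m = 2 * cos (pi * real m / (real k + 1))" for m :: nat
  have arg: "0 \<le> pi * real m / (real k + 1)" "pi * real m / (real k + 1) < pi" if "m \<in> {1..k}" for m
    using pi_fraction_bounds[OF that] by auto
  have inj: "inj_on f {1..k}"
  proof (rule inj_onI)
    fix i j assume i: "i \<in> {1..k}" and j: "j \<in> {1..k}" and "f i = f j"
    then have "cos (pi * real i / (real k + 1)) = cos (pi * real j / (real k + 1))"
      unfolding f_def by simp
    from cos_inj_pi[OF arg(1)[OF i] less_imp_le[OF arg(2)[OF i]] arg(1)[OF j]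
        less_imp_le[OF arg(2)[OF j]] this]
    show "i = j" by (simp add: add_nonneg_eq_0_iff)
  qed
  have gt: "f m \<noteq> -2" if "m \<in> {1..k}" for m
    using cos_monotone_0_pi[of "pi * real m / (real k + 1)" pi] arg[OF that] by (simp add: f_def)
  have "char_poly (wg_mat (5 * k + 1) k Suc 1 1 :: real Matrix.mat)
     = [:1, 1:] ^ k * ((\<Prod>z\<in>{0}. [:- of_real z, 1:]) * (\<Prod>y\<in>f ` {1..k}. wg_Q (of_real y)))"
  proof (rule char_poly_eq_prod_wg_Q[OF wg_mat_carrier])
    show "5 * k + 1 = k + card {0::real} + 4 * card (f ` {1..k})"
      using inj by (simp add: card_image)
    show "[:1, 1:] ^ k dvd char_poly (wg_mat (5 * k + 1) k Suc 1 1 :: real Matrix.mat)"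
      by (rule power_dvd_char_poly_wg_mat) simp
    show "f ` {1..k} \<subseteq> {-2..2}" using cos_ge_minus_one cos_le_one by (auto simp: f_def)
    show "poly (wg_Q y) z \<noteq> 0" if "y \<in> f ` {1..k}" "z \<in> {0}" for y z
      using that gt by (auto simp: poly_wg_Q_zero_iff)
    show "eigenvalue (wg_mat (5 * k + 1) k Suc 1 1) (of_real x :: real)"
      if "y \<in> f ` {1..k}" "poly (wg_Q y) x = 0" for x y
    proof -
      from that obtain m where m: "m \<in> {1..k}" "y = f m" by auto
      moreover have "x \<noteq> 0" using that m gt by (auto simp: poly_wg_Q_zero_iff)
      ultimately show ?thesis using eigenvalue_wg_path[of m k x] that by (simp add: f_def)
    qed
    show "eigenvalue (wg_mat (5 * k + 1) k Suc 1 1) (of_real z :: real)" if "z \<in> {0}" for z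
      using that eigenvalue_wg_path_zero by simp
  qed auto
  then show ?thesis unfolding prod.reindex[OF inj] o_def by (simp add: f_def)
qed

section \<open>The spectrum of the cycle\<close>

lemma real_not_int_multiple:
  fixes t a :: real
  assumes "0 < t" "t < a"
  shows "t \<noteq> a * of_int i"
proof
  assume "t = a * of_int i"
  then have "0 < of_int i * a" "of_int i * a < 1 * a" using assms by (auto simp: mult.commute)
  then have "0 < (of_int i :: real)" "(of_int i :: real) < 1"
    using assms by (auto simp: zero_less_mult_iff mult_less_cancel_right)
  then show False by simp
qed

text \<open>The eigenvector is a running wave given by powers of a \<open>k\<close>-th root of
  unity. The phase \<open>t / k\<close> on each of the \<open>k\<close> edges adds to its angle, so
  neighbouring values combine to \<open>2 * cos \<psi>\<close>.\<close>

lemma eigenvalue_wg_cycle: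
  fixes x t :: real and k m :: nat
  defines "\<psi> \<equiv> (2 * pi * real m + t) / real k"
  assumes k: "k \<ge> 2" and x: "poly (wg_Q (2 * cos \<psi>)) x = 0" "x \<noteq> 0"
  shows "eigenvalue (wg_mat (5 * k) k (\<lambda>j. Suc j mod k) (cis (t / k)) (cis (- t / k))) (of_real x)"
proof -
  define u where "u = cis (t / k)"
  define u' where "u' = cis (- t / k)"
  define \<omega> where "\<omega> = cis (2 * pi * real m / real k)"
  \<comment> \<open>Division by \<open>\<omega>\<close> steps back one place also at
    \<open>j = 0\<close>, where the predecessor is \<open>k - 1\<close>.\<close>
  define P where "P j = \<omega> ^ j + u' * (\<omega> ^ j / \<omega>)" for j
  have w0: "\<omega> \<noteq> 0" by (simp add: \<omega>_def)
  have wk: "\<omega> ^ k = 1"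
  proof -
    have "\<omega> ^ k = cis (real k * (2 * pi * real m / real k))" unfolding \<omega>_def by (rule Complex.DeMoivre)
    also have "\<dots> = cis (2 * pi * real m)" using k by simp
    also have "\<dots> = 1" by (rule cis_multiple_2pi) simp
    finally show ?thesis .
  qed
  have wmod: "\<omega> ^ (Suc j mod k) = \<omega> ^ Suc j" for j
  proof -
    have "\<omega> ^ Suc j = \<omega> ^ (k * (Suc j div k) + Suc j mod k)" by simp
    also have "\<dots> = \<omega> ^ (Suc j mod k)" by (simp only: power_add power_mult wk power_one mult_1)
    finally show ?thesis by simp
  qed
  have uu: "u * u' = 1" by (simp add: u_def u'_def cis_mult)
  have "u * \<omega> = cis \<psi>" by (simp add: u_def \<omega>_def \<psi>_def cis_mult add_divide_distrib add.commute)
  moreover have "u' / \<omega> = cis (- \<psi>)"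
    by (simp add: u'_def \<omega>_def \<psi>_def cis_divide add_divide_distrib algebra_simps)
  ultimately have sum: "u * \<omega> + u' / \<omega> = 2 * cos (complex_of_real \<psi>)"
    by (simp add: complex_eq_iff cos_of_real)
  show ?thesis
    unfolding u_def[symmetric] u'_def[symmetric]
  proof (rule eigenvalue_wg_mat_of_wave[where c = "\<lambda>j. \<omega> ^ j" and P = P and l = 0
        and y = "of_real (2 * cos \<psi>)"])
    show "P j = (if j < k then \<omega> ^ j else 0) + (\<Sum>i | i < k \<and> Suc i mod k = j. u' * \<omega> ^ i)"
      if "5 * j < 5 * k" for j
    proof -
      define i where "i = (if j = 0 then k - 1 else j - 1)"
      have ij: "{i. i < k \<and> Suc i mod k = j} = {i}"
        using k that by (auto simp: i_def mod_Suc split: if_splits)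
      have "Suc i mod k = j" using ij by auto
      then have "\<omega> ^ j = \<omega> ^ i * \<omega>" using wmod[of i] by simp
      then have "\<omega> ^ i = \<omega> ^ j / \<omega>" using w0 by simp
      then show ?thesis using ij that by (simp add: P_def)
    qed
    show "P j + u * P (Suc j mod k) = (2 + of_real (2 * cos \<psi>)) * \<omega> ^ j" for j
    proof -
      have "P j + u * P (Suc j mod k) = (1 + u * u' + (u * \<omega> + u' / \<omega>)) * \<omega> ^ j"
        unfolding P_def wmod using w0 by (simp add: field_simps)
      then show ?thesis unfolding uu sum by (simp add: cos_of_real)
    qed
    show "poly (wg_Q (of_real (2 * cos \<psi>))) (complex_of_real x) = 0"
      unfolding poly_wg_Q_of_real using x by simp
    show "Suc j mod k \<noteq> j \<and> 5 * (Suc j mod k) < 5 * k" if "j < k" for j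
      using that k by (auto simp: mod_Suc)
  qed (use k x w0 in auto)
qed

text \<open>For \<open>0 < t < pi\<close> the \<open>k\<close> cosines are distinct and none is -1,
  so their quartics account for all \<open>4 * k\<close> eigenvalues left beside the
  \<open>k\<close>-fold -1.\<close>

lemma char_poly_wg_cycle_twisted:
  assumes k: "k \<ge> 2" and t: "0 < t" "t < pi"
  shows "char_poly (wg_mat (5 * k) k (\<lambda>j. Suc j mod k) (cis (t / k)) (cis (- t / k)))
     = [:1, 1:] ^ k * (\<Prod>m<k. wg_Q (of_real (2 * cos ((2 * pi * real m + t) / real k))))"
proof -
  define f where "f m = 2 * cos ((2 * pi * real m + t) / real k)" for m :: nat
  have k0: "real k > 0" using k by simp
  have inj: "inj_on f {..<k}"
  proof (rule inj_onI)
    fix i j assume ij: "i \<in> {..<k}" "j \<in> {..<k}" "f i = f j"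
    define a where "a = (2 * pi * real i + t) / real k"
    define b where "b = (2 * pi * real j + t) / real k"
    \<comment> \<open>Equal cosines make \<open>a + b\<close> or \<open>b - a\<close> a multiple of
      \<open>2 * pi\<close>. The former would make \<open>t\<close> an integer multiple of pi; the
      latter makes \<open>j - i\<close> a multiple of \<open>k\<close>, hence 0.\<close>
    have "cos a - cos b = 0" using ij(3) by (simp add: f_def a_def b_def)
    then have "sin ((a + b) / 2) = 0 \<or> sin ((b - a) / 2) = 0" by (simp add: cos_diff_cos)
    then show "i = j"
    proof
      assume "sin ((a + b) / 2) = 0"
      then obtain l :: int where "(a + b) / 2 = of_int l * pi" using sin_zero_iff_int2 by blast
      moreover have "(a + b) / 2 = (pi * (real i + real j) + t) / k"
        by (simp add: a_def b_def algebra_simps add_divide_distrib)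
      ultimately have "t = pi * of_int (l * int k - int i - int j)"
        using k0 by (simp add: field_simps)
      with real_not_int_multiple[OF t] show ?thesis by blast
    next
      assume "sin ((b - a) / 2) = 0"
      then obtain l :: int where "(b - a) / 2 = of_int l * pi" using sin_zero_iff_int2 by blast
      moreover have "(b - a) / 2 = pi * (real j - real i) / k"
        by (simp add: a_def b_def algebra_simps add_divide_distrib diff_divide_distrib)
      ultimately have "pi * (real j - real i) = pi * (of_int l * real k)"
        using k0 by (simp add: field_simps)
      then have "real_of_int (int j - int i) = real_of_int (l * int k)"
        by (subst (asm) mult_left_cancel) auto
      then have e: "int j - int i = l * int k" by (simp only: of_int_eq_iff)
      have "\<bar>int j - int i\<bar> < int k" using ij by auto
      then have "\<bar>l\<bar> * int k < 1 * int k" unfolding e by (simp add: abs_mult)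
      then have "\<bar>l\<bar> < 1" using k by (subst (asm) mult_less_cancel_right) auto
      with e show ?thesis by simp
    qed
  qed
  have gt: "f m \<noteq> -2" for m
  proof
    assume "f m = -2"
    then have "cos ((2 * pi * real m + t) / real k) = -1" by (simp add: f_def)
    then obtain l :: int where "(2 * pi * real m + t) / real k = (2 * of_int l + 1) * pi"
      using cos_eq_minus1 by auto
    then have "t = pi * of_int ((2 * l + 1) * int k - 2 * int m)"
      using k0 by (simp add: field_simps)
    with real_not_int_multiple[OF t] show False by blast
  qed
  let ?A = "wg_mat (5 * k) k (\<lambda>j. Suc j mod k) (cis (t / k)) (cis (- t / k))"
  have "char_poly ?A
     = [:1, 1:] ^ k * ((\<Prod>z\<in>{}. [:- of_real z, 1:]) * (\<Prod>y\<in>f ` {..<k}. wg_Q (of_real y)))"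
  proof (rule char_poly_eq_prod_wg_Q[OF wg_mat_carrier])
    show "5 * k = k + card {} + 4 * card (f ` {..<k})"
      using inj by (simp add: card_image)
    show "[:1, 1:] ^ k dvd char_poly ?A" by (rule power_dvd_char_poly_wg_mat) simp
    show "f ` {..<k} \<subseteq> {-2..2}" using cos_ge_minus_one cos_le_one by (auto simp: f_def)
    show "eigenvalue ?A (of_real x)" if "y \<in> f ` {..<k}" "poly (wg_Q y) x = 0" for x y
    proof -
      from that obtain m where m: "y = f m" by auto
      moreover have "x \<noteq> 0" using that m gt by (auto simp: poly_wg_Q_zero_iff)
      ultimately show ?thesis using eigenvalue_wg_cycle[OF k, of m t x] that by (simp add: f_def)
    qed
  qed auto
  then show ?thesis unfolding prod.reindex[OF inj] o_def by (simp add: f_def)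
qed

text \<open>The twist separates the double eigenvalues of the cycle; it is removed by letting \<open>t\<close>
  tend to zero.\<close>

lemma char_poly_wg_cycle:
  assumes k: "k \<ge> 2"
  shows "char_poly (wg_mat (5 * k) k (\<lambda>j. Suc j mod k) 1 1 :: real Matrix.mat)
     = [:1, 1:] ^ k * (\<Prod>m<k. wg_Q (2 * cos (2 * pi * real m / real k)))"
proof -
  let ?nx = "\<lambda>j. Suc j mod k"
  let ?R = "wg_mat (5 * k) k ?nx 1 1 :: real Matrix.mat"
  let ?B = "wg_mat (5 * k) k ?nx 1 1 :: complex Matrix.mat"
  let ?A = "\<lambda>t. wg_mat (5 * k) k ?nx (cis (t / k)) (cis (- t / k))"
  have "poly (char_poly ?R) x = poly ([:1, 1:] ^ k * (\<Prod>m<k. wg_Q (2 * cos (2 * pi * real m / real k)))) x" for x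
  proof -
    \<comment> \<open>The twisted product at \<open>x\<close>; the claim is that its value at
      \<open>t = 0\<close> is that of the real characteristic polynomial.\<close>
    define g where "g t = (x + 1) ^ k * (\<Prod>m<k. poly (wg_Q (2 * cos ((2 * pi * real m + t) / real k))) x)" for t
    have "?B = map_mat of_real ?R"
      by (rule eq_matI) (auto simp: wg_mat_def wg_weight_def)
    then have "poly (char_poly ?B) (of_real x) = of_real (poly (char_poly ?R) x)"
      by (simp add: of_real_hom.char_poly_hom[OF wg_mat_carrier])
    \<comment> \<open>The limit is one-sided because the twisted formula holds for
      \<open>0 < t < pi\<close>.\<close>
    moreover have "((\<lambda>t. poly (char_poly (?A t)) (of_real x)) \<longlongrightarrow> poly (char_poly ?B) (of_real x)) (at_right 0)"
    proof (rule tendsto_poly_char_poly[OF wg_mat_carrier wg_mat_carrier])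
      have "((\<lambda>t::real. cis (t / k)) \<longlongrightarrow> cis (0 / k)) (at_right 0)"
        "((\<lambda>t::real. cis (- t / k)) \<longlongrightarrow> cis (- 0 / k)) (at_right 0)"
        using k by (intro tendsto_intros; simp)+
      then show "((\<lambda>t. ?A t $$ (i, j)) \<longlongrightarrow> ?B $$ (i, j)) (at_right 0)"
        if "i < 5 * k" "j < 5 * k" for i j
        using that wg_weight_cases[of i j, where 'a = complex] by (auto simp: wg_mat_def)
    qed
    moreover have "\<forall>\<^sub>F t in at_right 0. poly (char_poly (?A t)) (of_real x) = of_real (g t)"
    proof -
      have "\<forall>\<^sub>F t in at_right (0::real). t \<in> {0<..<pi}"
        by (rule eventually_at_right_real) simp
      then show ?thesis
      proof eventually_elim
        case (elim t)
        then have "char_poly (?A t) = [:1, 1:] ^ k *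
            (\<Prod>m<k. wg_Q (of_real (2 * cos ((2 * pi * real m + t) / real k))))"
          by (intro char_poly_wg_cycle_twisted k) auto
        then have "poly (char_poly (?A t)) (of_real x) = (of_real x + 1) ^ k *
            (\<Prod>m<k. poly (wg_Q (of_real (2 * cos ((2 * pi * real m + t) / real k)))) (of_real x))"
          by (simp add: poly_prod add.commute)
        then show ?case unfolding poly_wg_Q_of_real g_def by simp
      qed
    qed
    ultimately have "((\<lambda>t. complex_of_real (g t)) \<longlongrightarrow> of_real (poly (char_poly ?R) x)) (at_right 0)"
      using Lim_transform_eventually by simp
    moreover have "((\<lambda>t. complex_of_real (g t)) \<longlongrightarrow> of_real (g 0)) (at_right 0)"
      unfolding g_def poly_wg_Q by (intro tendsto_intros) (use k in auto)
    ultimately have "complex_of_real (poly (char_poly ?R) x) = of_real (g 0)"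
      by (rule tendsto_unique[rotated]) simp
    then have "poly (char_poly ?R) x = g 0" by (simp only: of_real_eq_iff)
    then show ?thesis by (simp add: g_def poly_prod add.commute)
  qed
  then show ?thesis by (intro poly_ext)
qed

section \<open>Energies and their limits\<close>

lemma root_abs_sum_prod_wg_Q:
  "root_abs_sum (\<Prod>m\<in>I. wg_Q (2 * cos (\<theta> m))) = real (card I) - 2 * (\<Sum>m\<in>I. wg_h (\<theta> m))"
proof -
  have nz: "wg_Q a \<noteq> 0" for a :: real by (metis degree_0 degree_wg_Q zero_neq_numeral)
  have "root_abs_sum (\<Prod>m\<in>I. wg_Q (2 * cos (\<theta> m))) = (\<Sum>m\<in>I. 1 - 2 * wg_h (\<theta> m))"
    using nz cos_ge_minus_one cos_le_one
    by (subst root_abs_sum_prod) (auto simp: root_abs_sum_wg_Q wg_h_def)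
  then show ?thesis by (simp add: sum_subtractf sum_distrib_left)
qed

lemma prod_wg_Q_neq_0: "(\<Prod>m\<in>I. wg_Q (f m :: real)) \<noteq> 0"
  by (cases "finite I") (auto simp: prod_zero_iff wg_Q_def)

lemma root_abs_sum_power_X_plus_1: "root_abs_sum ([:1, 1:] ^ k) = real k"
  by (simp add: root_abs_sum_power)

lemma graph_energy_wine_glass_path:
  "graph_energy (wine_glass_path k) = 2 * real k - 2 * (\<Sum>m = 1..k. wg_h (pi * real m / (real k + 1)))"
proof -
  have "graph_energy (wine_glass_path k)
    = root_abs_sum ([:1, 1:] ^ k * ([:0, 1:] * (\<Prod>m = 1..k. wg_Q (2 * cos (pi * real m / (real k + 1))))))"
    unfolding graph_energy_eq_root_abs_sum wine_glass_path_eq adjacency_matrix_eq_wg_mat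
      char_poly_wg_path ..
  also have "\<dots> = real k + (0 + root_abs_sum (\<Prod>m = 1..k. wg_Q (2 * cos (pi * real m / (real k + 1)))))"
    by (subst root_abs_sum_mult; (subst root_abs_sum_mult)?)
      (simp_all add: prod_wg_Q_neq_0 root_abs_sum_power_X_plus_1 del: mult_pCons_left)
  finally show ?thesis by (simp add: root_abs_sum_prod_wg_Q)
qed

lemma graph_energy_wine_glass_cycle:
  assumes "k \<ge> 2"
  shows "graph_energy (wine_glass_cycle k) = 2 * real k - 2 * (\<Sum>m<k. wg_h (2 * pi * real m / real k))"
proof -
  have "graph_energy (wine_glass_cycle k)
    = root_abs_sum ([:1, 1:] ^ k * (\<Prod>m<k. wg_Q (2 * cos (2 * pi * real m / real k))))"
    unfolding graph_energy_eq_root_abs_sum wine_glass_cycle_eq adjacency_matrix_eq_wg_mat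
      char_poly_wg_cycle[OF assms] ..
  also have "\<dots> = real k + root_abs_sum (\<Prod>m<k. wg_Q (2 * cos (2 * pi * real m / real k)))"
    by (subst root_abs_sum_mult) (simp_all add: prod_wg_Q_neq_0 root_abs_sum_power_X_plus_1)
  finally show ?thesis by (simp add: root_abs_sum_prod_wg_Q)
qed

text \<open>The energy sum becomes a Riemann sum with \<open>k + 1\<close> points once the term for
  angle 0 is added. The resulting corrections, \<open>wg_h 0 / k\<close> and the factor
  \<open>(k + 1) / k\<close>, tend to 0 and 1.\<close>

lemma wine_glass_path_limit:
  "(\<lambda>k. graph_energy (wine_glass_path k) / real (matching_number (wine_glass_path k))) \<longlonglongrightarrow> wg_L"
proof -
  define S where "S n = pi / real n * (\<Sum>j<n. wg_h (pi * real j / real n))" for n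
  have "S \<longlonglongrightarrow> integral {0..pi} wg_h"
    unfolding S_def by (rule riemann_sum_tendsto_integral) (auto intro: continuous_on_wg_h)
  then have "(\<lambda>k. S (Suc k)) \<longlonglongrightarrow> integral {0..pi} wg_h" by (rule LIMSEQ_Suc)
  moreover have "(\<lambda>k. real (Suc k) / real k) \<longlonglongrightarrow> 1"
    by (rule LIMSEQ_Suc_n_over_n)
  moreover have "(\<lambda>k. wg_h 0 / real k) \<longlonglongrightarrow> 0"
    by (rule lim_const_over_n)
  ultimately have "(\<lambda>k. 1 - (S (Suc k) * (real (Suc k) / real k) / pi - wg_h 0 / real k))
    \<longlonglongrightarrow> 1 - (integral {0..pi} wg_h * 1 / pi - 0)"
    by (intro tendsto_intros) auto
  note lim = this
  have eq: "1 - (S (Suc k) * (real (Suc k) / real k) / pi - wg_h 0 / real k)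
    = graph_energy (wine_glass_path k) / real (matching_number (wine_glass_path k))" if "k \<ge> 1" for k
  proof -
    have "(\<Sum>j<Suc k. wg_h (pi * real j / real (Suc k))) = wg_h 0 + (\<Sum>m = 1..k. wg_h (pi * real m / (real k + 1)))"
      by (subst sum.lessThan_Suc_shift)
        (simp add: sum.atLeast_Suc_atMost_Suc_shift atLeast0LessThan sum.atLeast1_atMost_eq add.commute)
    then have "S (Suc k) * (real (Suc k) / real k) / pi
      = (wg_h 0 + (\<Sum>m = 1..k. wg_h (pi * real m / (real k + 1)))) / k"
      unfolding S_def by simp
    moreover have "matching_number (wine_glass_path k) = 2 * k"
      unfolding wine_glass_path_eq by (rule matching_number_wg_edges)
    ultimately show ?thesis
      using that by (simp add: graph_energy_wine_glass_path diff_divide_distrib add_divide_distrib)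
  qed
  have "\<forall>\<^sub>F k in sequentially. 1 - (S (Suc k) * (real (Suc k) / real k) / pi - wg_h 0 / real k)
    = graph_energy (wine_glass_path k) / real (matching_number (wine_glass_path k))"
    using eventually_ge_at_top[of 1] by eventually_elim (rule eq)
  from Lim_transform_eventually[OF lim this] show ?thesis by (simp add: wg_L_eq_integral)
qed

text \<open>For \<open>k \<ge> 2\<close> the quotient is exactly 1 minus a normalized Riemann sum
  over a full turn.\<close>

lemma wine_glass_cycle_limit:
  "(\<lambda>k. graph_energy (wine_glass_cycle k) / real (matching_number (wine_glass_cycle k))) \<longlonglongrightarrow> wg_L"
proof -
  define S where "S n = 2 * pi / real n * (\<Sum>j<n. wg_h (2 * pi * real j / real n))" for n
  have "S \<longlonglongrightarrow> integral {0..2 * pi} wg_h"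
    unfolding S_def by (rule riemann_sum_tendsto_integral) (auto intro: continuous_on_wg_h)
  then have lim: "(\<lambda>k. 1 - S k / (2 * pi)) \<longlonglongrightarrow> 1 - integral {0..2 * pi} wg_h / (2 * pi)"
    by (intro tendsto_intros) auto
  have eq: "1 - S k / (2 * pi)
    = graph_energy (wine_glass_cycle k) / real (matching_number (wine_glass_cycle k))" if "k \<ge> 2" for k
  proof -
    have "matching_number (wine_glass_cycle k) = 2 * k"
      unfolding wine_glass_cycle_eq by (rule matching_number_wg_edges)
    then show ?thesis
      using that by (simp add: graph_energy_wine_glass_cycle S_def diff_divide_distrib)
  qed
  have "\<forall>\<^sub>F k in sequentially. 1 - S k / (2 * pi)
    = graph_energy (wine_glass_cycle k) / real (matching_number (wine_glass_cycle k))"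
    using eventually_ge_at_top[of 2] by eventually_elim (rule eq)
  from Lim_transform_eventually[OF lim this] show ?thesis
    by (simp add: wg_L_eq_integral integral_wg_h_double)
qed

theorem theorem4:
  shows "((\<lambda>k. graph_energy (wine_glass_path k) / real (matching_number (wine_glass_path k)))
            \<longlonglongrightarrow> wg_L) \<and>
         ((\<lambda>k. graph_energy (wine_glass_cycle k) / real (matching_number (wine_glass_cycle k)))
            \<longlonglongrightarrow> wg_L)"
  using wine_glass_path_limit wine_glass_cycle_limit by blast

end
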